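(* Let $\mathcal P_0$ be a set of noncommutative polynomials in $n$ indeterminates such that $p(0)=0$ for all $p\in\mathcal P_0$, and let $\widetilde\psi=(\widetilde\psi_1,\ldots,\widetilde\psi_n)\in F_n^\infty(\mathcal V_{\mathcal P_0})\otimes\mathbb C^n$ be a non-scalar operator with $\|\widetilde\psi\|\le1$. Then the following statements hold. (i) If $g\in\mathcal N_{\mathcal P_0}$ has the representation $\sum_{k=0}^\infty\sum_{|\alpha|=k}c_\alpha e_\alpha$, then $$g\circ\widetilde\psi:=\sum_{k=0}^\infty\sum_{|\alpha|=k}c_\alpha\widetilde\psi_\alpha1\in\mathcal N_{\mathcal P_0},$$ where the convergence of the series is in $F^2(H_n)$. (ii) The composition operator $C_{\widetilde\psi}:\mathcal N_{\mathcal P_0}\to\mathcal N_{\mathcal P_0}$ defined by $C_{\widetilde\psi}g:=g\circ\widetilde\psi$, $g\in\mathcal N_{\mathcal P_0}$, is bounded. Moreover, $$\|P_{\mathcal N_{\mathcal P_0}}z_{\psi(0)}\|\le\sup_{\mu\in\mathcal V_{\mathcal P_0}(\mathbb C)}\frac{\|P_{\mathcal N_{\mathcal P_0}}z_{\psi(\mu)}\|}{\|z_\mu\|}\le\|C_{\widetilde\psi}\|\le\left(\frac{1+\|\psi(0)\|}{1-\|\psi(0)\|}\right)^{1/2}.$$ (iii) The adjoint of the composition operator $C_{\widetilde\psi}:\mathcal N_{\mathcal P_0}\to\mathcal N_{\mathcal P_0}$ satisfies the formula $$C_{\widetilde\psi}^*g=\sum_{k=0}^\infty\sum_{|\alpha|=k}\langle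 g,\widetilde\psi_\alpha(1)\rangle P_{\mathcal N_{\mathcal P_0}}e_\alpha,\qquad g\in\mathcal N_{\mathcal P_0}.$$
   Context: $n\ge1$. $\mathbb F_n^+$ is the free semigroup with generators $g_1,\ldots,g_n$ and identity $g_0$; $|g_0|=0$, $|\alpha|=k$ if $\alpha=g_{i_1}\cdots g_{i_k}$; $T_\alpha:=T_{i_1}\cdots T_{i_k}$ for an $n$-tuple $(T_1,\ldots,T_n)$ of operators, $T_{g_0}:=I$. $H_n$ is an $n$-dimensional Hilbert space with orthonormal basis $e_1,\ldots,e_n$; $F^2(H_n)=\mathbb C1\oplus\bigoplus_{k\ge1}H_n^{\otimes k}$ is the full Fock space with orthonormal basis $e_\alpha:=e_{i_1}\otimes\cdots\otimes e_{i_k}$, $e_{g_0}:=1$; $S_i\xi:=e_i\otimes\xi$ are the left creation operators. Given $\mathcal P_0$, let $\mathcal M_{\mathcal P_0}:=\overline{\mathrm{span}}\{S_\alpha p(S_1,\ldots,S_n)S_\beta1:\ p\in\mathcal P_0,\ \alpha,\beta\in\mathbb F_n^+\}$ and $\mathcal N_{\mathcal P_0}:=F^2(H_n)\ominus\mathcal M_{\mathcal P_0}$, with orthogonal projection $P_{\mathcal N_{\mathcal P_0}}$; one has $1\in\mathcal N_{\mathcal P_0}$. Let $B_i:=P_{\mathcal N_{\mathcal P_0}}S_i|_{\mathcal N_{\mathcal P_0}}$, $i=1,\ldots,n$, and let $F_n^\infty(\mathcal V_{\mathcal P_0})$ be the $w^*$-closed algebra generated by $B_1,\ldots,B_n$ and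 the identity on $\mathcal N_{\mathcal P_0}$. An element $\widetilde\psi=(\widetilde\psi_1,\ldots,\widetilde\psi_n)\in F_n^\infty(\mathcal V_{\mathcal P_0})\otimes\mathbb C^n$ is an $n$-tuple of elements of $F_n^\infty(\mathcal V_{\mathcal P_0})$, viewed as a row operator $\mathcal N_{\mathcal P_0}\otimes\mathbb C^n\to\mathcal N_{\mathcal P_0}$ with the corresponding operator norm; it is non-scalar if it is not of the form $(a_1I_{\mathcal N_{\mathcal P_0}},\ldots,a_nI_{\mathcal N_{\mathcal P_0}})$ with $a_i\in\mathbb C$. $\widetilde\psi_\alpha:=\widetilde\psi_{i_1}\cdots\widetilde\psi_{i_k}$. $\mathbb B_n$ is the open Euclidean unit ball of $\mathbb C^n$, and $\mathcal V_{\mathcal P_0}(\mathbb C):=\{\mu\in\mathbb B_n:\ p(\mu)=0\ \text{for all }p\in\mathcal P_0\}$ (which contains $0$). For $\mu\in\mathbb B_n$, $z_\mu:=\sum_{\alpha\in\mathbb F_n^+}\overline\mu_\alpha e_\alpha\in F^2(H_n)$, where $\mu_\alpha:=\mu_{i_1}\cdots\mu_{i_k}$, $\mu_{g_0}:=1$. For $\mu\in\mathcal V_{\mathcal P_0}(\mathbb C)$ one has $z_\mu\in\mathcal N_{\mathcal P_0}$, and $\psi(\mu)=(\psi_1(\mu),\ldots,\psi_n(\mu))$ is the value at $\mu$ of the function generated by $\widetilde\psi$: writing $\widetilde\psi_i=P_{\mathcal N_{\mathcal P_0}}\widetilde\phi_i|_{\mathcal N_{\mathcal P_0}}$ with $\widetilde\phi_i=\sum_\alpha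 a_\alpha^{(i)}S_\alpha$ (Fourier representation) in the WOT-closed algebra $F_n^\infty$ generated by $S_1,\ldots,S_n$ and $I$ (always possible), $\psi_i(\mu)=\sum_{k=0}^\infty\sum_{|\alpha|=k}a^{(i)}_\alpha\mu_\alpha$; equivalently $\psi_i(\mu)=\langle\widetilde\psi_i1,z_\mu\rangle$, independent of the choice of $\widetilde\phi_i$. Under the hypotheses, $\psi(\mu)\in\mathbb B_n$. In particular $\psi_i(0)=\langle\widetilde\psi_i1,1\rangle$. *)

theory Defs
  imports "HOL-Analysis.Analysis" "HOL-Library.Poly_Mapping"
begin

section \<open>The complex Hilbert space \<open>\<ell>\<^sup>2\<close> over an index type\<close>

typedef 'a ell2 = "{f :: 'a \<Rightarrow> complex. (\<lambda>a. (cmod (f a))\<^sup>2) summable_on UNIV}"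
  morphisms coord Abs_ell2
  by (rule exI[of _ "\<lambda>_. 0"]) simp

setup_lifting type_definition_ell2

lemma ell2_eqI: "(\<And>a. coord x a = coord y a) \<Longrightarrow> x = y"
  by (metis coord_inject ext)

lemma coord_summable: "(\<lambda>a. (cmod (coord x a))\<^sup>2) summable_on A"
  using coord[of x] by (auto intro: summable_on_subset_banach)

lemma ell2_prod_abs_summable:
  fixes f g :: "'a \<Rightarrow> complex"
  assumes "(\<lambda>a. (cmod (f a))\<^sup>2) summable_on A" "(\<lambda>a. (cmod (g a))\<^sup>2) summable_on A"
  shows "(\<lambda>a. cmod (f a * g a)) summable_on A"
  by (rule abs_summable_product)
     (use assms in \<open>simp_all add: norm_mult power2_eq_square\<close>)

lemma ell2_prod_summable: "(\<lambda>a. coord x a * cnj (coord y a)) summable_on A"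
  by (rule abs_summable_summable, rule ell2_prod_abs_summable) (simp_all add: coord_summable)

lemma ell2_add_summable:
  fixes f g :: "'a \<Rightarrow> complex"
  assumes "(\<lambda>a. (cmod (f a))\<^sup>2) summable_on A" "(\<lambda>a. (cmod (g a))\<^sup>2) summable_on A"
  shows "(\<lambda>a. (cmod (f a + g a))\<^sup>2) summable_on A"
proof (rule summable_on_comparison_test)
  show "(\<lambda>a. 2 * (cmod (f a))\<^sup>2 + 2 * (cmod (g a))\<^sup>2) summable_on A"
    by (intro summable_on_add summable_on_cmult_right assms)
  fix a
  have "(cmod (f a + g a))\<^sup>2 \<le> (cmod (f a) + cmod (g a))\<^sup>2"
    by (intro power_mono norm_triangle_ineq) simp
  also have "\<dots> \<le> 2 * (cmod (f a))\<^sup>2 + 2 * (cmod (g a))\<^sup>2"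
    using zero_le_power2[of "cmod (f a) - cmod (g a)"]
    by (simp add: power2_eq_square algebra_simps)
  finally show "(cmod (f a + g a))\<^sup>2 \<le> 2 * (cmod (f a))\<^sup>2 + 2 * (cmod (g a))\<^sup>2" .
qed simp

lemma ell2_scale_summable:
  fixes f :: "'a \<Rightarrow> complex"
  assumes "(\<lambda>a. (cmod (f a))\<^sup>2) summable_on A"
  shows "(\<lambda>a. (cmod (c * f a))\<^sup>2) summable_on A"
  unfolding norm_mult power_mult_distrib by (rule summable_on_cmult_right) (rule assms)

lift_definition scaleC :: "complex \<Rightarrow> 'a ell2 \<Rightarrow> 'a ell2"  (infixr "*\<^sub>C" 75)
  is "\<lambda>c f a. c * f a"
  by (rule ell2_scale_summable)

text \<open>As in the source, the inner product is linear in its first argument.\<close>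

definition cinner :: "'a ell2 \<Rightarrow> 'a ell2 \<Rightarrow> complex" where
  "cinner x y = (\<Sum>\<^sub>\<infinity>a. coord x a * cnj (coord y a))"

instantiation ell2 :: (type) real_vector
begin

lift_definition zero_ell2 :: "'a ell2" is "\<lambda>_. 0" by simp
lift_definition plus_ell2 :: "'a ell2 \<Rightarrow> 'a ell2 \<Rightarrow> 'a ell2" is "\<lambda>f g a. f a + g a"
  by (rule ell2_add_summable)
lift_definition uminus_ell2 :: "'a ell2 \<Rightarrow> 'a ell2" is "\<lambda>f a. - f a" by simp
lift_definition minus_ell2 :: "'a ell2 \<Rightarrow> 'a ell2 \<Rightarrow> 'a ell2" is "\<lambda>f g a. f a - g a"
  using ell2_add_summable[of _ UNIV "\<lambda>a. - _ a"] by fastforce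
lift_definition scaleR_ell2 :: "real \<Rightarrow> 'a ell2 \<Rightarrow> 'a ell2" is "\<lambda>r f a. complex_of_real r * f a"
  by (rule ell2_scale_summable)

instance
  by standard (transfer; force simp: algebra_simps)+

end

lemma coord_simps [simp]:
  "coord 0 a = 0"
  "coord (x + y) a = coord x a + coord y a"
  "coord (x - y) a = coord x a - coord y a"
  "coord (- x) a = - coord x a"
  "coord (r *\<^sub>R x) a = complex_of_real r * coord x a"
  "coord (c *\<^sub>C x) a = c * coord x a"
  by (transfer; simp)+

lemma coord_sum [simp]: "coord (sum f A) a = (\<Sum>i\<in>A. coord (f i) a)"
  by (induction A rule: infinite_finite_induct) auto

lemma cinner_add_left: "cinner (x + y) z = cinner x z + cinner y z"
  unfolding cinner_def by (simp add: ring_distribs infsum_add ell2_prod_summable)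

lemma cinner_scaleC_left: "cinner (c *\<^sub>C x) y = c * cinner x y"
  unfolding cinner_def by (simp add: mult.assoc infsum_cmult_right')

lemma cinner_commute: "cinner x y = cnj (cinner y x)"
  unfolding cinner_def by (simp add: mult.commute flip: infsum_cnj)

lemma scaleR_scaleC: "r *\<^sub>R x = complex_of_real r *\<^sub>C x"
  by (rule ell2_eqI) simp

lemma cinner_self: "cinner x x = complex_of_real (\<Sum>\<^sub>\<infinity>a. (cmod (coord x a))\<^sup>2)"
  unfolding cinner_def complex_norm_square[symmetric]
  by (intro infsumI has_sum_of_real has_sum_infsum coord_summable)

instantiation ell2 :: (type) real_inner
begin

definition inner_ell2 :: "'a ell2 \<Rightarrow> 'a ell2 \<Rightarrow> real" where "inner_ell2 x y = Re (cinner x y)"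
definition norm_ell2 :: "'a ell2 \<Rightarrow> real" where "norm_ell2 x = sqrt (Re (cinner x x))"
definition sgn_ell2 :: "'a ell2 \<Rightarrow> 'a ell2" where "sgn_ell2 x = x /\<^sub>R norm x"
definition dist_ell2 :: "'a ell2 \<Rightarrow> 'a ell2 \<Rightarrow> real" where "dist_ell2 x y = norm (x - y)"
definition uniformity_ell2 :: "('a ell2 \<times> 'a ell2) filter" where
  "uniformity_ell2 = (INF e\<in>{0<..}. principal {(x, y). dist x y < e})"
definition open_ell2 :: "'a ell2 set \<Rightarrow> bool" where
  "open_ell2 U = (\<forall>x\<in>U. \<forall>\<^sub>F (x', y) in uniformity. x' = x \<longrightarrow> y \<in> U)"

instance
proof
  fix x y z :: "'a ell2" and r :: real
  show "inner x y = inner y x"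
    unfolding inner_ell2_def by (subst cinner_commute) simp
  show "inner (x + y) z = inner x z + inner y z"
    by (simp add: inner_ell2_def cinner_add_left)
  show "inner (r *\<^sub>R x) y = r * inner x y"
    by (simp add: inner_ell2_def scaleR_scaleC cinner_scaleC_left)
  show "0 \<le> inner x x"
    by (simp add: inner_ell2_def cinner_self infsum_nonneg)
  show "inner x x = 0 \<longleftrightarrow> x = 0"
  proof
    assume "inner x x = 0"
    then have "(\<Sum>\<^sub>\<infinity>a. (cmod (coord x a))\<^sup>2) = 0"
      by (simp add: inner_ell2_def cinner_self)
    then have "(cmod (coord x a))\<^sup>2 = 0" for a
      by (intro nonneg_infsum_le_0D[where A = UNIV]) (auto intro: coord_summable)
    then show "x = 0" by (intro ell2_eqI) simp
  qed (simp add: inner_ell2_def cinner_def)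
qed (simp_all add: inner_ell2_def norm_ell2_def sgn_ell2_def dist_ell2_def
      uniformity_ell2_def open_ell2_def)

end

lemma norm_ell2_eq: "norm x = sqrt (\<Sum>\<^sub>\<infinity>a. (cmod (coord x a))\<^sup>2)"
  by (simp add: norm_ell2_def cinner_self)

lemma sum_coord_le_norm:
  assumes "finite F" shows "(\<Sum>a\<in>F. (cmod (coord x a))\<^sup>2) \<le> (norm x)\<^sup>2"
proof -
  have "(\<Sum>a\<in>F. (cmod (coord x a))\<^sup>2) \<le> (\<Sum>\<^sub>\<infinity>a. (cmod (coord x a))\<^sup>2)"
    by (rule finite_sum_le_infsum) (use assms in \<open>auto intro: coord_summable\<close>)
  then show ?thesis by (simp add: norm_ell2_eq infsum_nonneg)
qed

lemma coord_le_norm: "cmod (coord x a) \<le> norm x"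
  by (rule power2_le_imp_le) (use sum_coord_le_norm[of "{a}" x] in simp_all)

instance ell2 :: (type) complete_space
proof
  fix X :: "nat \<Rightarrow> 'a ell2"
  assume C: "Cauchy X"
  have "Cauchy (\<lambda>n. coord (X n) a)" for a
  proof (rule metric_CauchyI)
    fix e :: real assume "e > 0"
    then obtain M where M: "\<And>m n. m \<ge> M \<Longrightarrow> n \<ge> M \<Longrightarrow> norm (X m - X n) < e"
      using C by (metis CauchyD)
    show "\<exists>M. \<forall>m\<ge>M. \<forall>n\<ge>M. dist (coord (X m) a) (coord (X n) a) < e"
    proof (intro exI[of _ M] allI impI)
      fix m n assume "M \<le> m" "M \<le> n"
      then show "dist (coord (X m) a) (coord (X n) a) < e"
        using M[of m n] coord_le_norm[of "X m - X n" a] by (simp add: dist_norm)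
    qed
  qed
  then have "\<exists>l. (\<lambda>n. coord (X n) a) \<longlonglongrightarrow> l" for a
    using Cauchy_convergent convergent_def by blast
  then obtain f where f: "\<And>a. (\<lambda>n. coord (X n) a) \<longlonglongrightarrow> f a" by metis
  have bd: "(\<Sum>a\<in>F. (cmod (coord (X m) a - f a))\<^sup>2) \<le> e\<^sup>2"
    if M: "\<And>m n. m \<ge> M \<Longrightarrow> n \<ge> M \<Longrightarrow> norm (X m - X n) < e" and "m \<ge> M" "finite F" for M m e F
  proof (rule tendsto_upperbound)
    show "(\<lambda>n. \<Sum>a\<in>F. (cmod (coord (X m) a - coord (X n) a))\<^sup>2)
      \<longlonglongrightarrow> (\<Sum>a\<in>F. (cmod (coord (X m) a - f a))\<^sup>2)"
      by (intro tendsto_intros f)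
    show "\<forall>\<^sub>F n in sequentially. (\<Sum>a\<in>F. (cmod (coord (X m) a - coord (X n) a))\<^sup>2) \<le> e\<^sup>2"
      unfolding eventually_sequentially
    proof (intro exI[of _ M] allI impI)
      fix n assume "n \<ge> M"
      have "(\<Sum>a\<in>F. (cmod (coord (X m) a - coord (X n) a))\<^sup>2) \<le> (norm (X m - X n))\<^sup>2"
        using sum_coord_le_norm[OF \<open>finite F\<close>, of "X m - X n"] by simp
      also have "\<dots> \<le> e\<^sup>2"
        by (rule power_mono) (use M[OF \<open>m \<ge> M\<close> \<open>n \<ge> M\<close>] in auto)
      finally show "(\<Sum>a\<in>F. (cmod (coord (X m) a - coord (X n) a))\<^sup>2) \<le> e\<^sup>2" .
    qed
  qed simp
  obtain M1 where M1: "\<And>m n. m \<ge> M1 \<Longrightarrow> n \<ge> M1 \<Longrightarrow> norm (X m - X n) < 1"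
    using C CauchyD[of X 1] by auto
  have s1: "(\<lambda>a. (cmod (coord (X M1) a - f a))\<^sup>2) summable_on UNIV"
    by (rule nonneg_bdd_above_summable_on)
       (use bd[OF M1 order.refl] in \<open>auto intro!: bdd_aboveI[of _ 1]\<close>)
  have "(\<lambda>a. (cmod (f a))\<^sup>2) summable_on UNIV"
    using ell2_add_summable[OF coord_summable[of "X M1"], of "\<lambda>a. f a - coord (X M1) a"] s1
    by (simp add: norm_minus_commute)
  then have cf: "coord (Abs_ell2 f) = f"
    by (simp add: Abs_ell2_inverse)
  have "X \<longlonglongrightarrow> Abs_ell2 f"
  proof (rule LIMSEQ_I)
    fix r :: real assume "r > 0"
    then obtain M where M: "\<And>m n. m \<ge> M \<Longrightarrow> n \<ge> M \<Longrightarrow> norm (X m - X n) < r / 2"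
      using C CauchyD[of X "r / 2"] by auto
    show "\<exists>no. \<forall>n\<ge>no. norm (X n - Abs_ell2 f) < r"
    proof (intro exI[of _ M] allI impI)
      fix n assume n: "n \<ge> M"
      have "(\<Sum>\<^sub>\<infinity>a. (cmod (coord (X n - Abs_ell2 f) a))\<^sup>2) \<le> (r / 2)\<^sup>2"
        by (rule infsum_le_finite_sums[OF coord_summable])
           (use bd[OF M n] in \<open>auto simp: cf\<close>)
      then have "norm (X n - Abs_ell2 f) \<le> r / 2"
        unfolding norm_ell2_eq using \<open>r > 0\<close> by (intro real_le_lsqrt) simp_all
      then show "norm (X n - Abs_ell2 f) < r" using \<open>r > 0\<close> by simp
    qed
  qed
  then show "convergent X" by (auto simp: convergent_def)
qed

instance ell2 :: (type) banach ..

interpretation ell2: vector_space "scaleC :: complex \<Rightarrow> 'a ell2 \<Rightarrow> 'a ell2"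
  by standard (auto intro!: ell2_eqI simp: algebra_simps)

lemma norm_scaleC: "norm (c *\<^sub>C x) = cmod c * norm x"
  by (simp add: norm_ell2_eq norm_mult power_mult_distrib infsum_cmult_right' real_sqrt_mult)

lemma cinner_Cauchy_Schwarz: "cmod (cinner x y) \<le> norm x * norm y"
proof (cases "cinner x y = 0")
  case False
  define c where "c = cnj (cinner x y) / complex_of_real (cmod (cinner x y))"
  have "cmod c = 1" using False by (simp add: c_def norm_divide)
  have "cinner (c *\<^sub>C x) y = complex_of_real (cmod (cinner x y))"
    using False complex_norm_square[of "cinner x y"]
    by (simp add: c_def cinner_scaleC_left field_simps power2_eq_square)
  then have "cmod (cinner x y) = inner (c *\<^sub>C x) y"
    by (simp add: inner_ell2_def)
  also have "\<dots> \<le> norm (c *\<^sub>C x) * norm y" by (rule norm_cauchy_schwarz)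
  finally show ?thesis by (simp add: norm_scaleC \<open>cmod c = 1\<close>)
qed simp

lemma bounded_linear_cinner_left: "bounded_linear (\<lambda>x. cinner x y)"
  by (rule bounded_linear_intro[where K = "norm y"])
     (auto simp: cinner_add_left scaleR_scaleC cinner_scaleC_left scaleR_conv_of_real
       intro: cinner_Cauchy_Schwarz)

lemma cinner_diff_left: "cinner (x - y) z = cinner x z - cinner y z"
  using bounded_linear_cinner_left bounded_linear.linear linear_diff by metis

lemma cinner_zero_left [simp]: "cinner 0 y = 0"
  by (simp add: cinner_def)

lemma cinner_add_right: "cinner x (y + z) = cinner x y + cinner x z"
  by (metis cinner_add_left cinner_commute complex_cnj_add)

lemma cinner_scaleC_right: "cinner x (c *\<^sub>C y) = cnj c * cinner x y"
  by (metis cinner_commute cinner_scaleC_left complex_cnj_mult)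

lemma cinner_zero_right [simp]: "cinner x 0 = 0"
  by (simp add: cinner_def)

lift_definition ket :: "'a \<Rightarrow> 'a ell2" is "\<lambda>a b. if b = a then 1 else 0"
proof -
  fix a :: 'a
  have "((\<lambda>b. (cmod (if b = a then 1 else 0))\<^sup>2) has_sum 1) UNIV"
    by (rule has_sum_finite_neutralI[of "{a}"]) auto
  then show "(\<lambda>b. (cmod (if b = a then 1 else 0))\<^sup>2) summable_on UNIV"
    by (rule has_sum_imp_summable)
qed

lemma coord_ket [simp]: "coord (ket a) b = (if b = a then 1 else 0)"
  by transfer simp

lemma ell2_has_sum_ket: "((\<lambda>a. coord x a *\<^sub>C ket a) has_sum x) UNIV"
proof -
  let ?f = "\<lambda>a. (cmod (coord x a))\<^sup>2"
  have nrm: "norm (x - (\<Sum>a\<in>F. coord x a *\<^sub>C ket a)) = sqrt (infsum ?f UNIV - sum ?f F)"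
    if "finite F" for F
  proof -
    have c: "coord (x - (\<Sum>a\<in>F. coord x a *\<^sub>C ket a)) b = (if b \<in> F then 0 else coord x b)" for b
      using that by (simp add: if_distrib sum.delta' cong: if_cong)
    have "(\<Sum>\<^sub>\<infinity>b. (cmod (if b \<in> F then 0 else coord x b))\<^sup>2) = infsum ?f (UNIV - F)"
      by (rule infsum_cong_neutral) auto
    also have "\<dots> = infsum ?f UNIV - infsum ?f F"
      by (rule infsum_Diff) (auto intro: coord_summable)
    finally show ?thesis using that unfolding norm_ell2_eq c by simp
  qed
  have "(sum ?f \<longlongrightarrow> infsum ?f UNIV) (finite_subsets_at_top UNIV)"
    using has_sum_infsum[OF coord_summable[of x UNIV]] by (simp add: has_sum_def)
  then have "((\<lambda>F. sqrt (infsum ?f UNIV - sum ?f F)) \<longlongrightarrow> sqrt (infsum ?f UNIV - infsum ?f UNIV))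
      (finite_subsets_at_top UNIV)"
    by (intro tendsto_intros)
  then have "((\<lambda>F. norm (x - (\<Sum>a\<in>F. coord x a *\<^sub>C ket a))) \<longlongrightarrow> 0) (finite_subsets_at_top UNIV)"
    by (rule filterlim_mono_eventually[OF _ order.refl order.refl, THEN tendsto_eq_rhs])
       (auto simp: nrm intro!: eventually_finite_subsets_at_top_weakI)
  then have "((\<lambda>F. norm ((\<Sum>a\<in>F. coord x a *\<^sub>C ket a) - x)) \<longlongrightarrow> 0) (finite_subsets_at_top UNIV)"
    by (simp add: norm_minus_commute)
  then show ?thesis
    unfolding has_sum_def by (subst Lim_null) (rule tendsto_norm_zero_cancel)
qed


section \<open>Bounded operators on a subspace\<close>

text \<open>
  Operators on a subspace \<open>N\<close> are functions on \<open>N\<close>, undefined outside \<open>N\<close>, so that equality of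
  operators is equality of HOL functions.
\<close>

definition bounded_ops :: "'a ell2 set \<Rightarrow> ('a ell2 \<Rightarrow> 'a ell2) set" where
  "bounded_ops N = {T \<in> N \<rightarrow>\<^sub>E N.
     (\<forall>x\<in>N. \<forall>y\<in>N. T (x + y) = T x + T y) \<and>
     (\<forall>c. \<forall>x\<in>N. T (c *\<^sub>C x) = c *\<^sub>C T x) \<and>
     (\<exists>K. \<forall>x\<in>N. norm (T x) \<le> K * norm x)}"

definition op_norm :: "'v::real_normed_vector set \<Rightarrow> ('v \<Rightarrow> 'w::real_normed_vector) \<Rightarrow> real" where
  "op_norm V T = (SUP x\<in>V. norm (T x) / norm x)"

definition orth_compl :: "'a ell2 set \<Rightarrow> 'a ell2 set" where
  "orth_compl M = {x. \<forall>y\<in>M. cinner x y = 0}"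

definition orth_proj :: "'a ell2 set \<Rightarrow> 'a ell2 \<Rightarrow> 'a ell2" where
  "orth_proj N x = (THE y. y \<in> N \<and> (\<forall>z\<in>N. cinner (x - y) z = 0))"

lemma subspace_orth_compl: "ell2.subspace (orth_compl M)"
  by (auto simp: orth_compl_def ell2.subspace_def cinner_add_left cinner_scaleC_left)

lemma closed_orth_compl: "closed (orth_compl M)"
proof -
  have "orth_compl M = (\<Inter>y\<in>M. {x. cinner x y = 0})" by (auto simp: orth_compl_def)
  moreover have "closed {x. cinner x y = 0}" for y :: "'a ell2"
    by (intro closed_Collect_eq continuous_intros
        linear_continuous_on bounded_linear_cinner_left)
  ultimately show ?thesis by auto
qed

lemma ex_orth_proj:
  fixes N :: "'a ell2 set"
  assumes N: "ell2.subspace N" "closed N"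
  shows "\<exists>y\<in>N. \<forall>z\<in>N. cinner (x - y) z = 0"
proof -
  define d where "d = infdist x N"
  have ne: "N \<noteq> {}" using ell2.subspace_0[OF N(1)] by auto
  have le: "d \<le> norm (x - y)" if "y \<in> N" for y
    using infdist_le[OF that, of x] by (simp add: d_def dist_norm)
  have "d \<ge> 0" by (simp add: d_def infdist_nonneg)
  have scR: "r *\<^sub>R y \<in> N" if "y \<in> N" for r y
    unfolding scaleR_scaleC using N(1) that by (rule ell2.subspace_scale)
  have "\<exists>y\<in>N. norm (x - y) < d + 1 / Suc n" for n
  proof -
    have "(INF a\<in>N. dist x a) < d + 1 / Suc n"
      using ne by (simp add: d_def infdist_def)
    then show ?thesis
      by (subst (asm) cINF_less_iff[OF ne]) (auto simp: dist_norm intro: bdd_belowI2[of _ 0])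
  qed
  then obtain Y where Y: "\<And>n. Y n \<in> N" "\<And>n. norm (x - Y n) < d + 1 / Suc n" by metis
  have par: "(norm (Y m - Y n))\<^sup>2 \<le> 2 * (norm (x - Y m))\<^sup>2 + 2 * (norm (x - Y n))\<^sup>2 - 4 * d\<^sup>2" for m n
  proof -
    have "d \<le> norm (x - (1/2) *\<^sub>R (Y m + Y n))"
      by (intro le scR ell2.subspace_add N Y)
    then have "d\<^sup>2 \<le> (norm (x - (1/2) *\<^sub>R (Y m + Y n)))\<^sup>2"
      using \<open>d \<ge> 0\<close> by (rule power_mono)
    moreover have "(norm (Y m - Y n))\<^sup>2 =
      2 * (norm (x - Y m))\<^sup>2 + 2 * (norm (x - Y n))\<^sup>2 - 4 * (norm (x - (1/2) *\<^sub>R (Y m + Y n)))\<^sup>2"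
      by (simp add: power2_norm_eq_inner inner_diff inner_add inner_commute algebra_simps)
    ultimately show ?thesis by simp
  qed
  have "Cauchy Y"
  proof (rule metric_CauchyI)
    fix e :: real assume e: "e > 0"
    have "(\<lambda>n. 4 * (d + 1 / real (Suc n))\<^sup>2 - 4 * d\<^sup>2) \<longlonglongrightarrow> 4 * (d + 0)\<^sup>2 - 4 * d\<^sup>2"
      by (intro tendsto_intros LIMSEQ_inverse_real_of_nat[unfolded inverse_eq_divide])
    then have "\<forall>\<^sub>F n in sequentially. 4 * (d + 1 / real (Suc n))\<^sup>2 - 4 * d\<^sup>2 < e\<^sup>2"
      using e by (intro order_tendstoD) auto
    then obtain M where M: "4 * (d + 1 / real (Suc M))\<^sup>2 - 4 * d\<^sup>2 < e\<^sup>2"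
      by (auto simp: eventually_sequentially)
    have nb: "(norm (x - Y n))\<^sup>2 \<le> (d + 1 / real (Suc M))\<^sup>2" if "n \<ge> M" for n
    proof (rule power_mono)
      have "1 / real (Suc n) \<le> 1 / real (Suc M)" using that by (simp add: frac_le)
      then show "norm (x - Y n) \<le> d + 1 / real (Suc M)" using Y(2)[of n] by linarith
    qed simp
    show "\<exists>M. \<forall>m\<ge>M. \<forall>n\<ge>M. dist (Y m) (Y n) < e"
    proof (intro exI[of _ M] allI impI)
      fix m n assume "M \<le> m" "M \<le> n"
      then have "(norm (Y m - Y n))\<^sup>2 < e\<^sup>2"
        using par[of m n] nb[of m] nb[of n] M by linarith
      then show "dist (Y m) (Y n) < e"
        using e by (simp add: dist_norm power2_less_imp_less)
    qed
  qed
  then obtain y where y: "Y \<longlonglongrightarrow> y" using Cauchy_convergent convergent_def by blast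
  have "y \<in> N" using closed_sequentially[OF N(2)] Y(1) y by blast
  have "norm (x - y) \<le> d + 0"
  proof (rule LIMSEQ_le)
    show "(\<lambda>n. norm (x - Y n)) \<longlonglongrightarrow> norm (x - y)" by (intro tendsto_intros y)
    show "(\<lambda>n. d + 1 / real (Suc n)) \<longlonglongrightarrow> d + 0"
      by (intro tendsto_intros LIMSEQ_inverse_real_of_nat[unfolded inverse_eq_divide])
    show "\<exists>N. \<forall>n\<ge>N. norm (x - Y n) \<le> d + 1 / real (Suc n)" using Y(2) less_imp_le by blast
  qed
  then have min: "norm (x - y) \<le> norm (x - y - w)" if "w \<in> N" for w
    using le[OF ell2.subspace_add[OF N(1) \<open>y \<in> N\<close> that]] by (simp add: diff_diff_eq)
  have re: "inner (x - y) w = 0" if "w \<in> N" for w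
  proof (cases "w = 0")
    case False
    define t where "t = inner (x - y) w / inner w w"
    have "(norm (x - y))\<^sup>2 \<le> (norm (x - y - t *\<^sub>R w))\<^sup>2"
      by (intro power_mono min scR that) simp
    also have "\<dots> = (norm (x - y))\<^sup>2 - (inner (x - y) w)\<^sup>2 / inner w w"
    proof -
      have "(norm (x - y - t *\<^sub>R w))\<^sup>2 = (norm (x - y))\<^sup>2 - 2 * t * inner (x - y) w + t\<^sup>2 * inner w w"
        unfolding power2_norm_eq_inner
        by (simp only: inner_diff_left[of "x - y" "t *\<^sub>R w"] inner_diff_right[of _ "x - y" "t *\<^sub>R w"]
            inner_commute[of w "x - y"] inner_scaleR_left inner_scaleR_right)
          (simp add: power2_eq_square algebra_simps)
      then show ?thesis using False by (simp add: t_def power2_eq_square field_simps)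
    qed
    finally show ?thesis using False by (simp add: divide_le_0_iff not_less flip: inner_gt_zero_iff)
  qed simp
  have "cinner (x - y) w = 0" if "w \<in> N" for w
  proof (rule complex_eqI)
    show "Re (cinner (x - y) w) = Re 0" using re[OF that] by (simp add: inner_ell2_def)
    have "inner (x - y) (\<i> *\<^sub>C w) = 0" by (intro re ell2.subspace_scale N that)
    then show "Im (cinner (x - y) w) = Im 0" by (simp add: inner_ell2_def cinner_scaleC_right)
  qed
  then show ?thesis using \<open>y \<in> N\<close> by blast
qed

lemma orth_proj:
  assumes N: "ell2.subspace N" "closed N"
  shows "orth_proj N x \<in> N" "z \<in> N \<Longrightarrow> cinner (x - orth_proj N x) z = 0"
proof -
  have "\<exists>!y. y \<in> N \<and> (\<forall>z\<in>N. cinner (x - y) z = 0)"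
  proof (rule ex_ex1I)
    fix y y' assume y: "y \<in> N \<and> (\<forall>z\<in>N. cinner (x - y) z = 0)" "y' \<in> N \<and> (\<forall>z\<in>N. cinner (x - y') z = 0)"
    then have "y' - y \<in> N" using ell2.subspace_diff[OF N(1)] by blast
    then have "cinner (x - y) (y' - y) - cinner (x - y') (y' - y) = 0" using y by simp
    then have "cinner (y' - y) (y' - y) = 0" by (simp flip: cinner_diff_left)
    then have "inner (y' - y) (y' - y) = 0" unfolding inner_ell2_def by simp
    then show "y = y'" by simp
  qed (use ex_orth_proj[OF N] in blast)
  from theI'[OF this] show "orth_proj N x \<in> N" "z \<in> N \<Longrightarrow> cinner (x - orth_proj N x) z = 0"
    by (auto simp: orth_proj_def)
qed

definition adjoint_on :: "'a ell2 set \<Rightarrow> ('a ell2 \<Rightarrow> 'a ell2) \<Rightarrow> 'a ell2 \<Rightarrow> 'a ell2" where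
  "adjoint_on N T = (THE A. A \<in> bounded_ops N \<and> (\<forall>x\<in>N. \<forall>y\<in>N. cinner (T x) y = cinner x (A y)))"

text \<open>
  The \<open>w\<^sup>*\<close>-topology of \<open>B(N)\<close> as the dual of the trace class operators on \<open>N\<close>; the trace class
  functionals are exactly the \<open>T \<mapsto> \<Sum>k. \<langle>T x\<^sub>k, y\<^sub>k\<rangle>\<close> with square summable \<open>(x\<^sub>k)\<close>, \<open>(y\<^sub>k)\<close> in \<open>N\<close>.
\<close>

definition weak_star_topology :: "'a ell2 set \<Rightarrow> ('a ell2 \<Rightarrow> 'a ell2) topology" where
  "weak_star_topology N = topology_generated_by
     {{T \<in> bounded_ops N. suminf (\<lambda>k. cinner (T (x k)) (y k)) \<in> U} | x y U.
        range x \<subseteq> N \<and> range y \<subseteq> N \<and>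
        summable (\<lambda>k::nat. (norm (x k))\<^sup>2) \<and> summable (\<lambda>k. (norm (y k))\<^sup>2) \<and> open U}"

definition unital_subalgebra :: "'a ell2 set \<Rightarrow> ('a ell2 \<Rightarrow> 'a ell2) set \<Rightarrow> bool" where
  "unital_subalgebra N \<A> \<longleftrightarrow> \<A> \<subseteq> bounded_ops N \<and> (\<lambda>x\<in>N. x) \<in> \<A> \<and>
     (\<forall>S\<in>\<A>. \<forall>T\<in>\<A>. (\<lambda>x\<in>N. S x + T x) \<in> \<A> \<and> compose N S T \<in> \<A>) \<and>
     (\<forall>c. \<forall>T\<in>\<A>. (\<lambda>x\<in>N. c *\<^sub>C T x) \<in> \<A>)"

definition weak_star_algebra ::
    "'a ell2 set \<Rightarrow> ('a ell2 \<Rightarrow> 'a ell2) set \<Rightarrow> ('a ell2 \<Rightarrow> 'a ell2) set" where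
  "weak_star_algebra N G =
     \<Inter>{\<A>. unital_subalgebra N \<A> \<and> closedin (weak_star_topology N) \<A> \<and> G \<subseteq> \<A>}"

primrec word_op :: "'h set \<Rightarrow> ('n \<Rightarrow> 'h \<Rightarrow> 'h) \<Rightarrow> 'n list \<Rightarrow> 'h \<Rightarrow> 'h" where
  "word_op N T [] = (\<lambda>x\<in>N. x)"
| "word_op N T (i # \<alpha>) = compose N (T i) (word_op N T \<alpha>)"


section \<open>The full Fock space and noncommutative varieties\<close>

text \<open>
  The free semigroup is \<open>'n list\<close> with \<open>n = CARD('n)\<close>. The full Fock space is identified with
  \<open>\<ell>\<^sup>2('n list)\<close> through its orthonormal basis: \<open>e\<^sub>\<alpha> = e\<^sub>i\<^sub>1 \<otimes> \<dots> \<otimes> e\<^sub>i\<^sub>k\<close> is \<^term>\<open>ket \<alpha>\<close>, and the vacuum vector \<open>1\<close> is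
  \<^term>\<open>ket []\<close>. In this picture \<open>e\<^sub>i \<otimes> e\<^sub>\<alpha> = e\<^sub>i\<^sub>\<alpha>\<close>.
\<close>

type_synonym 'n fock = "'n list ell2"

lift_definition creation :: "'n \<Rightarrow> 'n fock \<Rightarrow> 'n fock"
  is "\<lambda>i f \<alpha>. case \<alpha> of [] \<Rightarrow> 0 | j # \<beta> \<Rightarrow> if j = i then f \<beta> else 0"
proof -
  fix i :: 'n and f :: "'n list \<Rightarrow> complex"
  let ?g = "\<lambda>\<alpha>. (cmod (case \<alpha> of [] \<Rightarrow> 0 | j # \<beta> \<Rightarrow> if j = i then f \<beta> else 0))\<^sup>2"
  assume "(\<lambda>a. (cmod (f a))\<^sup>2) summable_on UNIV"
  then have "?g summable_on range (Cons i)"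
    by (subst summable_on_reindex) (auto simp: o_def)
  moreover have "?g summable_on range (Cons i) \<longleftrightarrow> ?g summable_on UNIV"
    by (rule summable_on_cong_neutral) (auto split: list.splits)
  ultimately show "?g summable_on UNIV" by simp
qed

lemma coord_creation [simp]:
  "coord (creation i x) [] = 0"
  "coord (creation i x) (j # \<beta>) = (if j = i then coord x \<beta> else 0)"
  by (transfer; simp)+

lemma creation_ket: "creation i (ket \<alpha>) = ket (i # \<alpha>)"
  by (rule ell2_eqI) (case_tac a; simp)

text \<open>A noncommutative polynomial is given by its coefficients at the words.\<close>

type_synonym 'n ncpoly = "'n list \<Rightarrow>\<^sub>0 complex"

definition ncpoly_creation :: "'n ncpoly \<Rightarrow> 'n fock \<Rightarrow> 'n fock" where
  "ncpoly_creation p x = (\<Sum>\<gamma>\<in>Poly_Mapping.keys p. Poly_Mapping.lookup p \<gamma> *\<^sub>C word_op UNIV creation \<gamma> x)"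

definition word_eval :: "complex ^ 'n \<Rightarrow> 'n list \<Rightarrow> complex" where
  "word_eval \<mu> \<alpha> = (\<Prod>i\<leftarrow>\<alpha>. \<mu> $ i)"

definition ncpoly_eval :: "'n ncpoly \<Rightarrow> complex ^ 'n \<Rightarrow> complex" where
  "ncpoly_eval p \<mu> = (\<Sum>\<gamma>\<in>Poly_Mapping.keys p. Poly_Mapping.lookup p \<gamma> * word_eval \<mu> \<gamma>)"

definition M_space :: "'n ncpoly set \<Rightarrow> 'n fock set" where
  "M_space \<P> = closure (ell2.span
     {word_op UNIV creation \<alpha> (ncpoly_creation p (word_op UNIV creation \<beta> (ket []))) | p \<alpha> \<beta>. p \<in> \<P>})"

definition N_space :: "'n ncpoly set \<Rightarrow> 'n fock set" where
  "N_space \<P> = orth_compl (M_space \<P>)"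

definition B_op :: "'n ncpoly set \<Rightarrow> 'n \<Rightarrow> 'n fock \<Rightarrow> 'n fock" where
  "B_op \<P> i = (\<lambda>x\<in>N_space \<P>. orth_proj (N_space \<P>) (creation i x))"

definition variety_algebra :: "'n ncpoly set \<Rightarrow> ('n fock \<Rightarrow> 'n fock) set" where
  "variety_algebra \<P> = weak_star_algebra (N_space \<P>) (range (B_op \<P>))"

definition scalar_variety :: "'n::finite ncpoly set \<Rightarrow> (complex ^ 'n) set" where
  "scalar_variety \<P> = {\<mu> \<in> ball 0 1. \<forall>p\<in>\<P>. ncpoly_eval p \<mu> = 0}"

definition z_vec :: "complex ^ 'n \<Rightarrow> 'n fock" where
  "z_vec \<mu> = (\<Sum>\<^sub>\<infinity>\<alpha>. cnj (word_eval \<mu> \<alpha>) *\<^sub>C ket \<alpha>)"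

definition row_op :: "('n::finite \<Rightarrow> 'n fock \<Rightarrow> 'n fock) \<Rightarrow> 'n fock ^ 'n \<Rightarrow> 'n fock" where
  "row_op \<psi> x = (\<Sum>i\<in>UNIV. \<psi> i (x $ i))"

text \<open>
  The value \<open>\<psi>(\<mu>)\<close> of the function generated by \<open>\<psi>\<close>. The lemma \<open>symbol_value_lift\<close> below
  shows that it is the value at \<open>\<mu>\<close> of the Fourier series of any lift of \<open>\<psi>\<close> to the Fock space.
\<close>

definition symbol_value :: "('n \<Rightarrow> 'n fock \<Rightarrow> 'n fock) \<Rightarrow> complex ^ 'n \<Rightarrow> complex ^ 'n" where
  "symbol_value \<psi> \<mu> = (\<chi> i. cinner (\<psi> i (ket [])) (z_vec \<mu>))"

text \<open>The coefficient of \<open>e\<^sub>\<alpha>\<close> in the expansion of \<open>g\<close> is \<^term>\<open>coord g \<alpha>\<close>, see \<open>ell2_has_sum_ket\<close>.\<close>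

definition composition_term ::
    "'n ncpoly set \<Rightarrow> ('n \<Rightarrow> 'n fock \<Rightarrow> 'n fock) \<Rightarrow> 'n fock \<Rightarrow> nat \<Rightarrow> 'n fock" where
  "composition_term \<P> \<psi> g k =
     (\<Sum>\<alpha> | length \<alpha> = k. coord g \<alpha> *\<^sub>C word_op (N_space \<P>) \<psi> \<alpha> (ket []))"

definition composition_op ::
    "'n ncpoly set \<Rightarrow> ('n \<Rightarrow> 'n fock \<Rightarrow> 'n fock) \<Rightarrow> 'n fock \<Rightarrow> 'n fock" where
  "composition_op \<P> \<psi> = (\<lambda>g\<in>N_space \<P>. suminf (composition_term \<P> \<psi> g))"


section \<open>Values of the generated function as values of Fourier series\<close>

lemma subspace_N_space: "ell2.subspace (N_space \<P>)" and closed_N_space: "closed (N_space \<P>)"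
  by (simp_all add: N_space_def subspace_orth_compl closed_orth_compl)

lemma words_Suc: "{\<alpha>. length \<alpha> = Suc k} = (\<lambda>(i, \<beta>). i # \<beta>) ` (UNIV \<times> {\<beta>. length \<beta> = k})"
  by (auto simp: length_Suc_conv image_iff)

lemma finite_words: "finite {\<alpha> :: 'n::finite list. length \<alpha> = k}"
  using finite_lists_length_eq[of "UNIV :: 'n set" k] by simp

lemma sum_word_eval:
  fixes \<mu> :: "complex ^ 'n::finite"
  shows "(\<Sum>\<alpha> | length \<alpha> = k. (cmod (word_eval \<mu> \<alpha>))\<^sup>2) = (norm \<mu>) ^ (2 * k)"
proof (induction k)
  case (Suc k)
  have "(\<Sum>\<alpha> | length \<alpha> = Suc k. (cmod (word_eval \<mu> \<alpha>))\<^sup>2)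
    = (\<Sum>i\<in>UNIV. (cmod (\<mu> $ i))\<^sup>2 * (\<Sum>\<beta> | length \<beta> = k. (cmod (word_eval \<mu> \<beta>))\<^sup>2))"
    unfolding words_Suc
    by (subst sum.reindex) (auto simp: inj_on_def word_eval_def norm_mult power_mult_distrib
        sum_distrib_left sum.cartesian_product intro!: sum.cong)
  also have "\<dots> = (norm \<mu>)\<^sup>2 * norm \<mu> ^ (2 * k)"
    by (simp add: Suc flip: sum_distrib_right) (simp add: norm_vec_def L2_set_def sum_nonneg)
  finally show ?case by (simp add: power2_eq_square)
qed (simp add: word_eval_def)

lemma word_eval_summable:
  fixes \<mu> :: "complex ^ 'n::finite"
  assumes "norm \<mu> < 1"
  shows "(\<lambda>\<alpha>. (cmod (cnj (word_eval \<mu> \<alpha>)))\<^sup>2) summable_on UNIV"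
proof (rule nonneg_bdd_above_summable_on)
  have "(\<Sum>\<alpha>\<in>F. (cmod (word_eval \<mu> \<alpha>))\<^sup>2) \<le> 1 / (1 - (norm \<mu>)\<^sup>2)" if "finite F" for F
  proof -
    define m where "m = Suc (Max (insert 0 (length ` F)))"
    have "F \<subseteq> (\<Union>k<m. {\<alpha>. length \<alpha> = k})"
      using that by (auto simp: m_def less_Suc_eq_le intro!: Max_ge)
    then have "(\<Sum>\<alpha>\<in>F. (cmod (word_eval \<mu> \<alpha>))\<^sup>2)
      \<le> (\<Sum>\<alpha>\<in>(\<Union>k<m. {\<alpha>. length \<alpha> = k}). (cmod (word_eval \<mu> \<alpha>))\<^sup>2)"
      by (intro sum_mono2) (auto intro!: finite_words)
    also have "\<dots> = (\<Sum>k<m. \<Sum>\<alpha> | length \<alpha> = k. (cmod (word_eval \<mu> \<alpha>))\<^sup>2)"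
      by (rule sum.UNION_disjoint) (auto intro!: finite_words)
    also have "\<dots> = (\<Sum>k<m. ((norm \<mu>)\<^sup>2) ^ k)" by (simp add: sum_word_eval power_mult)
    also have "\<dots> \<le> suminf ((^) ((norm \<mu>)\<^sup>2))"
      using assms by (intro sum_le_suminf summable_geometric) (auto simp: power_less_one_iff abs_square_less_1)
    also have "\<dots> = 1 / (1 - (norm \<mu>)\<^sup>2)"
      using assms by (intro suminf_geometric) (auto simp: abs_square_less_1)
    finally show ?thesis .
  qed
  then show "bdd_above (sum (\<lambda>\<alpha>. (cmod (cnj (word_eval \<mu> \<alpha>)))\<^sup>2) ` {F. F \<subseteq> UNIV \<and> finite F})"
    by (auto intro!: bdd_aboveI)
qed simp

lemma coord_z_vec:
  fixes \<mu> :: "complex ^ 'n::finite"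
  assumes "norm \<mu> < 1"
  shows "coord (z_vec \<mu>) \<alpha> = cnj (word_eval \<mu> \<alpha>)"
proof -
  define x where "x = Abs_ell2 (\<lambda>\<alpha>. cnj (word_eval \<mu> \<alpha>))"
  have c: "coord x = (\<lambda>\<alpha>. cnj (word_eval \<mu> \<alpha>))"
    unfolding x_def by (rule Abs_ell2_inverse) (use word_eval_summable[OF assms] in simp)
  have "z_vec \<mu> = x"
    unfolding z_vec_def using ell2_has_sum_ket[of x] by (intro infsumI) (simp add: c)
  then show ?thesis by (simp add: c)
qed

lemma z_vec_0: "z_vec (0 :: complex ^ 'n::finite) = ket []"
proof (rule ell2_eqI)
  fix \<alpha> :: "'n list"
  show "coord (z_vec 0) \<alpha> = coord (ket []) \<alpha>"
    by (cases \<alpha>) (simp_all add: coord_z_vec word_eval_def)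
qed

lemma cinner_creation_z:
  fixes \<mu> :: "complex ^ 'n::finite"
  assumes "norm \<mu> < 1"
  shows "cinner (creation i x) (z_vec \<mu>) = \<mu> $ i * cinner x (z_vec \<mu>)"
proof -
  have "cinner (creation i x) (z_vec \<mu>)
      = (\<Sum>\<^sub>\<infinity>\<alpha>\<in>range (Cons i). coord (creation i x) \<alpha> * word_eval \<mu> \<alpha>)"
    unfolding cinner_def coord_z_vec[OF assms] complex_cnj_cnj
  proof (rule infsum_cong_neutral)
    fix \<alpha> assume "\<alpha> \<in> UNIV - range (Cons i)"
    then show "coord (creation i x) \<alpha> * word_eval \<mu> \<alpha> = 0" by (cases \<alpha>) auto
  qed auto
  also have "\<dots> = (\<Sum>\<^sub>\<infinity>\<alpha>. \<mu> $ i * (coord x \<alpha> * word_eval \<mu> \<alpha>))"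
    by (subst infsum_reindex) (auto simp: o_def word_eval_def mult_ac)
  also have "\<dots> = \<mu> $ i * cinner x (z_vec \<mu>)"
    by (simp add: infsum_cmult_right' cinner_def coord_z_vec[OF assms])
  finally show ?thesis .
qed

lemma cinner_word_op_z:
  fixes \<mu> :: "complex ^ 'n::finite"
  assumes "norm \<mu> < 1"
  shows "cinner (word_op UNIV creation \<alpha> x) (z_vec \<mu>) = word_eval \<mu> \<alpha> * cinner x (z_vec \<mu>)"
  by (induction \<alpha>) (auto simp: word_eval_def compose_def cinner_creation_z[OF assms])

lemma cinner_ncpoly_z:
  fixes \<mu> :: "complex ^ 'n::finite"
  assumes "norm \<mu> < 1"
  shows "cinner (ncpoly_creation p x) (z_vec \<mu>) = ncpoly_eval p \<mu> * cinner x (z_vec \<mu>)"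
proof -
  have "cinner (sum f A) y = (\<Sum>a\<in>A. cinner (f a) y)" for f :: "'n list \<Rightarrow> 'n fock" and A y
    by (rule linear_sum[OF bounded_linear.linear[OF bounded_linear_cinner_left]])
  then show ?thesis
    by (simp add: ncpoly_creation_def ncpoly_eval_def cinner_scaleC_left
        cinner_word_op_z[OF assms] sum_distrib_right mult.assoc)
qed

lemma z_vec_in_N_space:
  assumes "\<mu> \<in> scalar_variety \<P>" shows "z_vec \<mu> \<in> N_space \<P>"
proof -
  have \<mu>: "norm \<mu> < 1" "\<And>p. p \<in> \<P> \<Longrightarrow> ncpoly_eval p \<mu> = 0"
    using assms by (auto simp: scalar_variety_def)
  have "M_space \<P> \<subseteq> orth_compl {z_vec \<mu>}"
    unfolding M_space_def
    by (intro closure_minimal ell2.span_minimal subspace_orth_compl closed_orth_compl)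
       (auto simp: orth_compl_def cinner_word_op_z cinner_ncpoly_z \<mu>)
  then have "cinner y (z_vec \<mu>) = 0" if "y \<in> M_space \<P>" for y
    using that by (auto simp: orth_compl_def)
  then have "cinner (z_vec \<mu>) y = 0" if "y \<in> M_space \<P>" for y
    using that by (subst cinner_commute) simp
  then show ?thesis by (simp add: N_space_def orth_compl_def)
qed

lemma vacuum_in_N_space:
  fixes \<P> :: "'n::finite ncpoly set"
  assumes "\<forall>p\<in>\<P>. ncpoly_eval p 0 = 0"
  shows "ket [] \<in> N_space \<P>"
  using z_vec_in_N_space[of 0 \<P>] assms by (simp add: scalar_variety_def z_vec_0)

lemma cinner_z_sums:
  fixes \<mu> :: "complex ^ 'n::finite"
  assumes "norm \<mu> < 1"
  shows "(\<lambda>k. \<Sum>\<alpha> | length \<alpha> = k. coord x \<alpha> * word_eval \<mu> \<alpha>) sums cinner x (z_vec \<mu>)"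
proof -
  let ?f = "\<lambda>\<alpha>. coord x \<alpha> * word_eval \<mu> \<alpha>"
  have "(?f has_sum cinner x (z_vec \<mu>)) UNIV"
    using has_sum_infsum[OF ell2_prod_summable[of x "z_vec \<mu>" UNIV]]
    by (simp add: cinner_def coord_z_vec[OF assms])
  moreover have "bij_betw snd (SIGMA k:UNIV. {\<alpha> :: 'n list. length \<alpha> = k}) UNIV"
    by (auto simp: bij_betw_def inj_on_def image_iff)
  ultimately have "((\<lambda>(k, \<alpha>). ?f \<alpha>) has_sum cinner x (z_vec \<mu>)) (SIGMA k:UNIV. {\<alpha>. length \<alpha> = k})"
    by (subst (asm) has_sum_reindex_bij_betw[symmetric]) (auto simp: case_prod_unfold)
  then have "((\<lambda>k. \<Sum>\<alpha> | length \<alpha> = k. ?f \<alpha>) has_sum cinner x (z_vec \<mu>)) UNIV"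
    by (rule has_sum_SigmaD) (simp add: finite_words has_sum_finite)
  then show ?thesis by (rule has_sum_imp_sums)
qed

text \<open>
  If \<open>\<psi>\<^sub>i\<close> is the compression to \<open>N\<close> of an operator \<open>\<phi> = \<Sum>\<alpha>. a\<^sub>\<alpha> S\<^sub>\<alpha>\<close> on the Fock space, then
  \<open>a\<^sub>\<alpha> = \<langle>\<phi> 1, e\<^sub>\<alpha>\<rangle>\<close>, and the Fourier series of \<open>\<phi>\<close> evaluates to \<open>\<psi>\<^sub>i(\<mu>)\<close>; in particular the
  value does not depend on the choice of \<open>\<phi>\<close>.
\<close>

lemma symbol_value_lift:
  fixes \<P> :: "'n::finite ncpoly set"
  assumes "\<forall>p\<in>\<P>. ncpoly_eval p 0 = 0" and \<mu>: "\<mu> \<in> scalar_variety \<P>"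
    and \<psi>: "\<psi> i = (\<lambda>x\<in>N_space \<P>. orth_proj (N_space \<P>) (\<phi> x))"
  shows "(\<lambda>k. \<Sum>\<alpha> | length \<alpha> = k. coord (\<phi> (ket [])) \<alpha> * word_eval \<mu> \<alpha>) sums (symbol_value \<psi> \<mu> $ i)"
proof -
  have "cinner (\<phi> (ket []) - \<psi> i (ket [])) (z_vec \<mu>) = 0"
    using orth_proj(2)[OF subspace_N_space closed_N_space z_vec_in_N_space[OF \<mu>]]
      vacuum_in_N_space[OF assms(1)] by (simp add: \<psi>)
  then have "cinner (\<phi> (ket [])) (z_vec \<mu>) = symbol_value \<psi> \<mu> $ i"
    by (simp add: cinner_diff_left symbol_value_def)
  then show ?thesis
    using cinner_z_sums[of \<mu> "\<phi> (ket [])"] \<mu> by (simp add: scalar_variety_def)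
qed

end

(*
  The set of all T with <T y, z_mu> = <T 1, z_mu> <y, z_mu> for all y is a weak-star closed unital
  algebra containing the B_i, so each psi_i is evaluated multiplicatively at z_mu, and the adjoints
  psi_i^* have 1 as an eigenvector.  Put a = psi(0), r = |a|.  For a row contraction with this property
  and F = d 1 + sum_i psi_i y_i, an elementary computation gives
    |F|^2 + r |<F,1>|^2 <= (1+r)/(1-r) |d|^2 + sum_i (|y_i|^2 + r |<y_i,1>|^2),
  and iterating it on words bounds |sum c_alpha psi_alpha 1|^2 by (1+r)/(1-r) sum |c_alpha|^2: this is
  both the convergence of the composition series and the upper norm estimate, without dilations or
  automorphisms of the ball.  The coefficient vector (<g, psi_alpha 1>)_alpha is then square summable
  and, compressed to N, it is C^* g; for g = z_mu it is z_psi(mu), which also forces |psi(mu)| < 1 and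
  gives the lower estimates.  That r < 1 uses that psi is not scalar.
*)
theory Submission
  imports Defs
begin

section \<open>Geometry of the sequence space: testing against vectors and orthogonal
  projections\<close>

section \<open>Inner products and projections\<close>

lemma cinner_sum_left: "cinner (sum f A) y = (\<Sum>a\<in>A. cinner (f a) y)"
  by (rule linear_sum[OF bounded_linear.linear[OF bounded_linear_cinner_left]])

lemma cinner_sum_right: "cinner x (sum f A) = (\<Sum>a\<in>A. cinner x (f a))"
  by (subst cinner_commute, subst cinner_sum_left) (simp flip: cinner_commute)

lemma cinner_diff_right: "cinner x (y - z) = cinner x y - cinner x z"
  by (metis cinner_commute cinner_diff_left complex_cnj_diff)

lemma cinner_self_norm: "cinner x x = complex_of_real ((norm x)\<^sup>2)"
  by (simp add: cinner_self norm_ell2_eq infsum_nonneg)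

lemma cinner_eqI:
  assumes "\<And>z. cinner x z = cinner y z" shows "x = y"
proof -
  have "cinner (x - y) (x - y) = 0" by (subst cinner_diff_left) (simp add: assms)
  then show ?thesis by (simp add: cinner_self_norm)
qed

lemma cinner_ket_right [simp]: "cinner x (ket \<alpha>) = coord x \<alpha>"
proof -
  have "cinner x (ket \<alpha>) = (\<Sum>\<^sub>\<infinity>b\<in>{\<alpha>}. coord x b * cnj (coord (ket \<alpha>) b))"
    unfolding cinner_def by (rule infsum_cong_neutral) auto
  then show ?thesis by simp
qed

lemma norm_ket [simp]: "norm (ket \<alpha>) = 1"
proof -
  have "complex_of_real ((norm (ket \<alpha>))\<^sup>2) = 1"
    unfolding cinner_self_norm[symmetric] by simp
  then have "(norm (ket \<alpha>))\<^sup>2 = 1" by (simp only: of_real_eq_1_iff)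
  then show ?thesis using norm_ge_zero[of "ket \<alpha>"] by (simp add: power2_eq_1_iff)
qed

lemma norm_add_sq:
  "(norm (x + y :: 'a ell2))\<^sup>2 = (norm x)\<^sup>2 + 2 * Re (cinner x y) + (norm y)\<^sup>2"
  by (simp add: power2_norm_eq_inner inner_add inner_commute flip: inner_ell2_def)

lemma orth_proj_cinner:
  assumes "ell2.subspace N" "closed N" "z \<in> N"
  shows "cinner (orth_proj N x) z = cinner x z" "cinner z (orth_proj N x) = cinner z x"
proof -
  show "cinner (orth_proj N x) z = cinner x z"
    using orth_proj(2)[OF assms, of x] by (simp add: cinner_diff_left)
  then show "cinner z (orth_proj N x) = cinner z x"
    by (metis cinner_commute)
qed

lemma eq_on_subspaceI:
  assumes "ell2.subspace N" "x \<in> N" "y \<in> N" "\<And>z. z \<in> N \<Longrightarrow> cinner x z = cinner y z"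
  shows "x = y"
proof -
  have "cinner (x - y) (x - y) = 0"
    using assms(4)[OF ell2.subspace_diff[OF assms(1-3)]] by (subst cinner_diff_left) simp
  then show ?thesis by (simp add: cinner_self_norm)
qed

text \<open>Everything is read off from inner products with vectors of \<open>N\<close>; the bound
  is Cauchy-Schwarz applied to |Px|^2 = <x, Px>.\<close>

lemma bounded_linear_orth_proj:
  assumes "ell2.subspace N" "closed N"
  shows "bounded_linear (orth_proj N)"
    and "orth_proj N (c *\<^sub>C x) = c *\<^sub>C orth_proj N x"
    and "x \<in> N \<Longrightarrow> orth_proj N x = x"
proof -
  note P = orth_proj(1)[OF assms] and c = orth_proj_cinner(1)[OF assms]
    and sub = ell2.subspace_add[OF assms(1)] ell2.subspace_scale[OF assms(1)]
  show sc: "orth_proj N (c *\<^sub>C x) = c *\<^sub>C orth_proj N x" for c x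
    by (rule eq_on_subspaceI[OF assms(1)]) (simp_all add: P c sub cinner_scaleC_left)
  show "x \<in> N \<Longrightarrow> orth_proj N x = x"
    by (rule eq_on_subspaceI[OF assms(1)]) (simp_all add: P c)
  show "bounded_linear (orth_proj N)"
  proof (rule bounded_linear_intro[where K = 1])
    show "orth_proj N (x + y) = orth_proj N x + orth_proj N y" for x y
      by (rule eq_on_subspaceI[OF assms(1)]) (simp_all add: P c sub cinner_add_left)
    show "orth_proj N (r *\<^sub>R x) = r *\<^sub>R orth_proj N x" for r x
      by (simp add: scaleR_scaleC sc)
    fix x
    have "complex_of_real ((norm (orth_proj N x))\<^sup>2) = cinner x (orth_proj N x)"
      unfolding cinner_self_norm[symmetric] by (simp add: c P)
    then have "(norm (orth_proj N x))\<^sup>2 \<le> norm x * norm (orth_proj N x)"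
      by (metis cinner_Cauchy_Schwarz norm_of_real abs_of_nonneg zero_le_power2)
    then show "norm (orth_proj N x) \<le> norm x * 1"
      by (cases "orth_proj N x = 0") (auto simp: power2_eq_square)
  qed
qed

section \<open>Regrouping sums over the free semigroup\<close>

section \<open>Sums over words\<close>

text \<open>Unconditional summability allows grouping by length, and each group is finite because
  the alphabet is.\<close>

lemma has_sum_words_sums:
  fixes f :: "'n::finite list \<Rightarrow> 'b::{topological_comm_monoid_add, t3_space}"
  assumes "(f has_sum s) UNIV"
  shows "(\<lambda>k. \<Sum>\<alpha> | length \<alpha> = k. f \<alpha>) sums s"
proof -
  have "bij_betw snd (SIGMA k:UNIV. {\<alpha> :: 'n list. length \<alpha> = k}) UNIV"
    by (auto simp: bij_betw_def inj_on_def image_iff)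
  with assms have "((\<lambda>(k, \<alpha>). f \<alpha>) has_sum s) (SIGMA k:UNIV. {\<alpha>. length \<alpha> = k})"
    by (subst (asm) has_sum_reindex_bij_betw[symmetric]) (auto simp: case_prod_unfold)
  then have "((\<lambda>k. \<Sum>\<alpha> | length \<alpha> = k. f \<alpha>) has_sum s) UNIV"
    by (rule has_sum_SigmaD) (simp add: finite_words has_sum_finite)
  then show ?thesis by (rule has_sum_imp_sums)
qed

lemma finite_words_less: "finite {\<alpha> :: 'n::finite list. length \<alpha> < m}"
proof -
  have "{\<alpha> :: 'n list. length \<alpha> < m} = (\<Union>k<m. {\<alpha>. length \<alpha> = k})" by auto
  then show ?thesis by (simp add: finite_words)
qed

text \<open>Splitting nonempty words at the first letter is the recursion behind the induction in
  \<open>gram_bound_less\<close>.\<close>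

lemma sum_words_less_Suc:
  fixes f :: "'n::finite list \<Rightarrow> 'b::comm_monoid_add"
  shows "sum f {\<alpha>. length \<alpha> < Suc m} = f [] + (\<Sum>i\<in>UNIV. \<Sum>\<beta> | length \<beta> < m. f (i # \<beta>))"
proof -
  have "{\<alpha> :: 'n list. length \<alpha> < Suc m}
      = insert [] ((\<lambda>(i, \<beta>). i # \<beta>) ` (UNIV \<times> {\<beta>. length \<beta> < m}))"
  proof (intro set_eqI)
    fix \<alpha> :: "'n list"
    show "\<alpha> \<in> {\<alpha>. length \<alpha> < Suc m}
      \<longleftrightarrow> \<alpha> \<in> insert [] ((\<lambda>(i, \<beta>). i # \<beta>) ` (UNIV \<times> {\<beta>. length \<beta> < m}))"
      by (cases \<alpha>) (auto simp: image_iff)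
  qed
  then have "sum f {\<alpha>. length \<alpha> < Suc m}
      = f [] + sum f ((\<lambda>(i, \<beta>). i # \<beta>) ` (UNIV \<times> {\<beta>. length \<beta> < m}))"
    by (simp add: finite_words_less) (subst sum.insert, auto simp: finite_words_less)
  also have "sum f ((\<lambda>(i, \<beta>). i # \<beta>) ` (UNIV \<times> {\<beta>. length \<beta> < m}))
      = (\<Sum>i\<in>UNIV. \<Sum>\<beta> | length \<beta> < m. f (i # \<beta>))"
    by (subst sum.reindex) (auto simp: inj_on_def sum.cartesian_product intro!: sum.cong)
  finally show ?thesis .
qed

section \<open>Linear conditions that pass to weak-star closed algebras\<close>

section \<open>Weak-star closed algebras\<close>

text \<open>Zero sequences and \<open>UNIV\<close> exhibit all of \<open>bounded_ops N\<close> as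
  one of the generating open sets.\<close>

lemma topspace_weak_star:
  assumes "0 \<in> N" shows "topspace (weak_star_topology N) = bounded_ops N"
proof -
  have "\<exists>x y U. bounded_ops N = {T \<in> bounded_ops N. suminf (\<lambda>k. cinner (T (x k)) (y k)) \<in> U} \<and>
        range x \<subseteq> N \<and> range y \<subseteq> N \<and>
        summable (\<lambda>k::nat. (norm (x k))\<^sup>2) \<and> summable (\<lambda>k. (norm (y k))\<^sup>2) \<and> open U"
    by (intro exI[of _ "\<lambda>_. 0"] exI[of _ UNIV]) (use assms in auto)
  then show ?thesis
    unfolding weak_star_topology_def topology_generated_by_topspace by blast
qed

text \<open>The condition is the vanishing of one trace class functional of rank at most two, hence
  the preimage of the closed set \<open>{0}\<close>.\<close>

lemma closedin_weak_star_eq: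
  assumes N: "ell2.subspace N" and "x \<in> N" "y \<in> N" "x' \<in> N" "y' \<in> N"
  shows "closedin (weak_star_topology N) {T \<in> bounded_ops N. cinner (T x) y = cinner (T x') y'}"
proof -
  have 0: "0 \<in> N" by (rule ell2.subspace_0[OF N])
  have neg: "- y' \<in> N" using ell2.subspace_neg[OF N assms(5)] .
  \<comment> \<open>Padding with zeros turns a difference of two matrix coefficients into one
    admissible series; the minus sign sits on \<open>y'\<close>.\<close>
  define xs ys where "xs = (\<lambda>k::nat. if k = 0 then x else if k = 1 then x' else 0)"
    and "ys = (\<lambda>k::nat. if k = 0 then y else if k = 1 then - y' else 0)"
  have fin: "summable f" if "\<And>k. k > 1 \<Longrightarrow> f k = 0" for f :: "nat \<Rightarrow> real"
    by (rule summable_finite[of "{..1}"]) (use that in auto)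
  have s: "suminf (\<lambda>k. cinner (T (xs k)) (ys k)) = cinner (T x) y - cinner (T x') y'" for T
  proof -
    have "suminf (\<lambda>k. cinner (T (xs k)) (ys k)) = (\<Sum>k\<in>{0,1}. cinner (T (xs k)) (ys k))"
      by (rule suminf_finite) (auto simp: ys_def)
    also have "\<dots> = cinner (T x) y - cinner (T x') y'"
      using cinner_diff_right[of "T x'" 0 y'] by (simp add: xs_def ys_def)
    finally show ?thesis .
  qed
  have "openin (weak_star_topology N)
      {T \<in> bounded_ops N. suminf (\<lambda>k. cinner (T (xs k)) (ys k)) \<in> - {0}}"
    unfolding weak_star_topology_def
    by (intro topology_generated_by_Basis CollectI exI[of _ xs] exI[of _ ys] exI[of _ "- {0}"])
       (use assms 0 neg in \<open>auto simp: xs_def ys_def intro!: fin\<close>)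
  moreover have "bounded_ops N - {T \<in> bounded_ops N. cinner (T x) y = cinner (T x') y'}
      = {T \<in> bounded_ops N. suminf (\<lambda>k. cinner (T (xs k)) (ys k)) \<in> - {0}}"
    by (auto simp: s)
  ultimately show ?thesis
    by (auto simp: closedin_def topspace_weak_star[OF 0])
qed

text \<open>Closed sets are intersected. The empty family is treated apart, since its intersection
  would be \<open>UNIV\<close> and not the carrier.\<close>

lemma closedin_weak_star_Ball:
  assumes "ell2.subspace N"
    and "\<And>i. i \<in> I \<Longrightarrow> x i \<in> N \<and> y i \<in> N \<and> x' i \<in> N \<and> y' i \<in> N"
  shows "closedin (weak_star_topology N)
    {T \<in> bounded_ops N. \<forall>i\<in>I. cinner (T (x i)) (y i) = cinner (T (x' i)) (y' i)}"
proof (cases "I = {}")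
  case True
  then show ?thesis
    using closedin_topspace[of "weak_star_topology N"]
    by (simp add: topspace_weak_star[OF ell2.subspace_0[OF assms(1)]])
next
  case False
  have "closedin (weak_star_topology N)
      (\<Inter>i\<in>I. {T \<in> bounded_ops N. cinner (T (x i)) (y i) = cinner (T (x' i)) (y' i)})"
    using False assms by (intro closedin_INT closedin_weak_star_eq) auto
  moreover have "(\<Inter>i\<in>I. {T \<in> bounded_ops N. cinner (T (x i)) (y i) = cinner (T (x' i)) (y' i)})
      = {T \<in> bounded_ops N. \<forall>i\<in>I. cinner (T (x i)) (y i) = cinner (T (x' i)) (y' i)}"
    using False by auto
  ultimately show ?thesis by simp
qed

lemma bounded_opsD:
  assumes "T \<in> bounded_ops N"
  shows "x \<in> N \<Longrightarrow> T x \<in> N" "x \<in> N \<Longrightarrow> y \<in> N \<Longrightarrow> T (x + y) = T x + T y"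
    "x \<in> N \<Longrightarrow> T (c *\<^sub>C x) = c *\<^sub>C T x" "x \<notin> N \<Longrightarrow> T x = undefined"
  using assms by (auto simp: bounded_ops_def)

lemma bounded_ops_bound:
  assumes "T \<in> bounded_ops N"
  obtains K where "K \<ge> 0" "\<And>x. x \<in> N \<Longrightarrow> norm (T x) \<le> K * norm x"
proof -
  from assms obtain K where "\<forall>x\<in>N. norm (T x) \<le> K * norm x"
    unfolding bounded_ops_def by blast
  then have "norm (T x) \<le> \<bar>K\<bar> * norm x" if "x \<in> N" for x
    using that by (meson abs_ge_self mult_right_mono norm_ge_zero order_trans)
  then show ?thesis using that[of "\<bar>K\<bar>"] by simp
qed

lemma bounded_ops_id: "(\<lambda>x\<in>N. x) \<in> bounded_ops N" if "ell2.subspace N"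
  using ell2.subspace_add[OF that] ell2.subspace_scale[OF that]
  by (auto simp: bounded_ops_def intro!: exI[of _ 1])

lemma bounded_ops_add:
  assumes N: "ell2.subspace N" and S: "S \<in> bounded_ops N" and T: "T \<in> bounded_ops N"
  shows "(\<lambda>x\<in>N. S x + T x) \<in> bounded_ops N"
proof -
  obtain K where K: "\<And>x. x \<in> N \<Longrightarrow> norm (S x) \<le> K * norm x" using bounded_ops_bound[OF S] by blast
  obtain L where L: "\<And>x. x \<in> N \<Longrightarrow> norm (T x) \<le> L * norm x" using bounded_ops_bound[OF T] by blast
  have "norm (S x + T x) \<le> (K + L) * norm x" if "x \<in> N" for x
    using norm_triangle_ineq[of "S x" "T x"] K[OF that] L[OF that] by (simp add: algebra_simps)
  then show ?thesis
    using ell2.subspace_add[OF N] ell2.subspace_scale[OF N] bounded_opsD[OF S] bounded_opsD[OF T]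
    by (auto simp: bounded_ops_def ell2.scale_right_distrib)
qed

lemma bounded_ops_scale:
  assumes N: "ell2.subspace N" and T: "T \<in> bounded_ops N"
  shows "(\<lambda>x\<in>N. c *\<^sub>C T x) \<in> bounded_ops N"
proof -
  obtain L where L: "\<And>x. x \<in> N \<Longrightarrow> norm (T x) \<le> L * norm x" using bounded_ops_bound[OF T] by blast
  have "norm (c *\<^sub>C T x) \<le> (cmod c * L) * norm x" if "x \<in> N" for x
    using mult_left_mono[OF L[OF that], of "cmod c"] by (simp add: norm_scaleC mult.assoc)
  then show ?thesis
    using ell2.subspace_add[OF N] ell2.subspace_scale[OF N] bounded_opsD[OF T]
    by (auto simp: bounded_ops_def ell2.scale_right_distrib ell2.scale_left_commute
        intro!: exI[of _ "cmod c * L"])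
qed

lemma bounded_ops_compose:
  assumes N: "ell2.subspace N" and S: "S \<in> bounded_ops N" and T: "T \<in> bounded_ops N"
  shows "compose N S T \<in> bounded_ops N"
proof -
  obtain K where K: "K \<ge> 0" "\<And>x. x \<in> N \<Longrightarrow> norm (S x) \<le> K * norm x" using bounded_ops_bound[OF S] by blast
  obtain L where L: "\<And>x. x \<in> N \<Longrightarrow> norm (T x) \<le> L * norm x" using bounded_ops_bound[OF T] by blast
  have "norm (S (T x)) \<le> (K * L) * norm x" if "x \<in> N" for x
    using K(2)[OF bounded_opsD(1)[OF T that]] mult_left_mono[OF L[OF that] K(1)] by (simp add: mult.assoc)
  then show ?thesis
    using ell2.subspace_add[OF N] ell2.subspace_scale[OF N] bounded_opsD[OF S] bounded_opsD[OF T]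
    by (auto simp: bounded_ops_def compose_def)
qed

lemma unital_subalgebra_Collect:
  assumes N: "ell2.subspace N" and "Q (\<lambda>x\<in>N. x)"
    and "\<And>S T. S \<in> bounded_ops N \<Longrightarrow> T \<in> bounded_ops N \<Longrightarrow> Q S \<Longrightarrow> Q T \<Longrightarrow> Q (\<lambda>x\<in>N. S x + T x)"
    and "\<And>S T. S \<in> bounded_ops N \<Longrightarrow> T \<in> bounded_ops N \<Longrightarrow> Q S \<Longrightarrow> Q T \<Longrightarrow> Q (compose N S T)"
    and "\<And>c T. T \<in> bounded_ops N \<Longrightarrow> Q T \<Longrightarrow> Q (\<lambda>x\<in>N. c *\<^sub>C T x)"
  shows "unital_subalgebra N {T \<in> bounded_ops N. Q T}"
  unfolding unital_subalgebra_def using assms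
  by (simp add: bounded_ops_id bounded_ops_add bounded_ops_compose bounded_ops_scale)

lemma weak_star_algebra_subset:
  assumes "unital_subalgebra N \<A>" "closedin (weak_star_topology N) \<A>" "G \<subseteq> \<A>"
  shows "weak_star_algebra N G \<subseteq> \<A>"
  using assms by (auto simp: weak_star_algebra_def)

section \<open>Left and right shifts, and what they say about the variety algebra\<close>

section \<open>Creation operators and the variety algebra\<close>

lift_definition annihilation :: "'n \<Rightarrow> 'n fock \<Rightarrow> 'n fock" is "\<lambda>i f \<alpha>. f (i # \<alpha>)"
proof -
  fix i :: 'n and f :: "'n list \<Rightarrow> complex"
  assume "(\<lambda>a. (cmod (f a))\<^sup>2) summable_on UNIV"
  then have "(\<lambda>a. (cmod (f a))\<^sup>2) summable_on range (Cons i)"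
    by (rule summable_on_subset_banach) simp
  then show "(\<lambda>a. (cmod (f (i # a)))\<^sup>2) summable_on UNIV"
    by (subst (asm) summable_on_reindex) (auto simp: o_def)
qed

text \<open>The adjoint of \<open>right_creation\<close>. Left and right shifts act on opposite ends
  of a word, which is what makes compressed right shifts commute with the variety algebra.\<close>

lift_definition right_annihilation :: "'n \<Rightarrow> 'n fock \<Rightarrow> 'n fock" is "\<lambda>j f \<alpha>. f (\<alpha> @ [j])"
proof -
  fix j :: 'n and f :: "'n list \<Rightarrow> complex"
  assume "(\<lambda>a. (cmod (f a))\<^sup>2) summable_on UNIV"
  then have "(\<lambda>a. (cmod (f a))\<^sup>2) summable_on range (\<lambda>\<alpha>. \<alpha> @ [j])"
    by (rule summable_on_subset_banach) simp
  then show "(\<lambda>a. (cmod (f (a @ [j])))\<^sup>2) summable_on UNIV"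
    by (subst (asm) summable_on_reindex) (auto simp: o_def inj_on_def)
qed

lift_definition right_creation :: "'n \<Rightarrow> 'n fock \<Rightarrow> 'n fock"
  is "\<lambda>j f \<alpha>. if \<alpha> \<noteq> [] \<and> last \<alpha> = j then f (butlast \<alpha>) else 0"
proof -
  fix j :: 'n and f :: "'n list \<Rightarrow> complex"
  let ?g = "\<lambda>\<alpha>. (cmod (if \<alpha> \<noteq> [] \<and> last \<alpha> = j then f (butlast \<alpha>) else 0))\<^sup>2"
  assume "(\<lambda>a. (cmod (f a))\<^sup>2) summable_on UNIV"
  then have "?g summable_on range (\<lambda>\<alpha>. \<alpha> @ [j])"
    by (subst summable_on_reindex) (auto simp: o_def inj_on_def)
  moreover have "?g summable_on range (\<lambda>\<alpha>. \<alpha> @ [j]) \<longleftrightarrow> ?g summable_on UNIV"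
  proof (rule summable_on_cong_neutral)
    fix \<alpha> assume "\<alpha> \<in> UNIV - range (\<lambda>\<alpha>. \<alpha> @ [j])"
    then show "?g \<alpha> = 0" by (cases \<alpha> rule: rev_cases) auto
  qed auto
  ultimately show "?g summable_on UNIV" by simp
qed

lemma coord_annihilation [simp]:
  "coord (annihilation i x) \<alpha> = coord x (i # \<alpha>)"
  "coord (right_annihilation j x) \<alpha> = coord x (\<alpha> @ [j])"
  by (transfer; simp)+

lemma coord_right_creation [simp]:
  "coord (right_creation j x) [] = 0"
  "coord (right_creation j x) (\<beta> @ [i]) = (if i = j then coord x \<beta> else 0)"
  by (transfer; simp)+

lemma right_creation_ket: "right_creation j (ket \<alpha>) = ket (\<alpha> @ [j])"
proof (rule ell2_eqI)
  fix \<beta> show "coord (right_creation j (ket \<alpha>)) \<beta> = coord (ket (\<alpha> @ [j])) \<beta>"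
    by (cases \<beta> rule: rev_cases) auto
qed

lemma annihilation_right_annihilation:
  "annihilation i (right_annihilation j x) = right_annihilation j (annihilation i x)"
  by (rule ell2_eqI) simp

lemma cinner_creation: "cinner (creation i x) y = cinner x (annihilation i y)"
proof -
  have "cinner (creation i x) y
      = (\<Sum>\<^sub>\<infinity>\<alpha>\<in>range (Cons i). coord (creation i x) \<alpha> * cnj (coord y \<alpha>))"
    unfolding cinner_def
  proof (rule infsum_cong_neutral)
    fix \<alpha> assume "\<alpha> \<in> UNIV - range (Cons i)"
    then show "coord (creation i x) \<alpha> * cnj (coord y \<alpha>) = 0" by (cases \<alpha>) auto
  qed auto
  then show ?thesis
    by (simp add: infsum_reindex o_def cinner_def)
qed

lemma cinner_right_creation: "cinner (right_creation j x) y = cinner x (right_annihilation j y)"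
proof -
  have "cinner (right_creation j x) y
      = (\<Sum>\<^sub>\<infinity>\<alpha>\<in>range (\<lambda>\<alpha>. \<alpha> @ [j]). coord (right_creation j x) \<alpha> * cnj (coord y \<alpha>))"
    unfolding cinner_def
  proof (rule infsum_cong_neutral)
    fix \<alpha> assume "\<alpha> \<in> UNIV - range (\<lambda>\<alpha>. \<alpha> @ [j])"
    then show "coord (right_creation j x) \<alpha> * cnj (coord y \<alpha>) = 0"
      by (cases \<alpha> rule: rev_cases) auto
  qed auto
  then show ?thesis
    by (simp add: infsum_reindex inj_on_def o_def cinner_def)
qed

lemma creation_linear:
  "creation i (x + y) = creation i x + creation i y"
  "creation i (c *\<^sub>C x) = c *\<^sub>C creation i x"
  by (rule ell2_eqI, case_tac a; simp)+

lemma norm_creation: "norm (creation i x) = norm x"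
proof -
  have "annihilation i (creation i x) = x" by (rule ell2_eqI) simp
  then have "cinner (creation i x) (creation i x) = cinner x x" by (simp add: cinner_creation)
  then show ?thesis by (simp add: norm_ell2_def)
qed

lemma word_op_creation_ket: "word_op UNIV creation \<alpha> (ket \<beta>) = ket (\<alpha> @ \<beta>)"
  by (induction \<alpha>) (simp_all add: compose_def creation_ket)

lemma word_op_creation_linear:
  "word_op UNIV creation \<alpha> (x + y) = word_op UNIV creation \<alpha> x + word_op UNIV creation \<alpha> y"
  "word_op UNIV creation \<alpha> (c *\<^sub>C x) = c *\<^sub>C word_op UNIV creation \<alpha> x"
  by (induction \<alpha>) (simp_all add: compose_def creation_linear)

lemma word_op_creation_sum:
  "word_op UNIV creation \<alpha> (sum f A) = (\<Sum>a\<in>A. word_op UNIV creation \<alpha> (f a))"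
proof -
  have "word_op UNIV creation \<alpha> (0 :: 'a fock) = 0"
    using word_op_creation_linear(2)[of \<alpha> 0 0] by simp
  then show ?thesis
    by (induction A rule: infinite_finite_induct) (simp_all add: word_op_creation_linear)
qed

lemma cinner_eq_0_sym: "cinner x y = 0 \<Longrightarrow> cinner y x = 0"
  by (subst cinner_commute) simp

text \<open>Orthogonal complements are closed subspaces, so only the spanning vectors need testing,
  and these are finite combinations of the basis vectors
  \<open>ket (\<alpha> @ \<gamma> @ \<beta>)\<close>. The free words on both sides reflect a
  two-sided ideal.\<close>

lemma N_space_iff:
  "x \<in> N_space \<P> \<longleftrightarrow> (\<forall>p\<in>\<P>. \<forall>\<alpha> \<beta>.
     (\<Sum>\<gamma>\<in>Poly_Mapping.keys p. cnj (Poly_Mapping.lookup p \<gamma>) * coord x (\<alpha> @ \<gamma> @ \<beta>)) = 0)"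
proof -
  define G where "G = {word_op UNIV creation \<alpha> (ncpoly_creation p (word_op UNIV creation \<beta> (ket [])))
      | p \<alpha> \<beta>. p \<in> \<P>}"
  have "x \<in> N_space \<P> \<longleftrightarrow> (\<forall>y\<in>G. cinner x y = 0)"
  proof
    assume "x \<in> N_space \<P>"
    moreover have "G \<subseteq> M_space \<P>"
      unfolding M_space_def G_def[symmetric]
      using ell2.span_superset closure_subset by (rule order_trans)
    ultimately show "\<forall>y\<in>G. cinner x y = 0"
      by (auto simp: N_space_def orth_compl_def)
  next
    assume G: "\<forall>y\<in>G. cinner x y = 0"
    have "M_space \<P> \<subseteq> orth_compl {x}"
      unfolding M_space_def G_def[symmetric]
      using G by (intro closure_minimal ell2.span_minimal subspace_orth_compl closed_orth_compl)
        (auto simp: orth_compl_def cinner_eq_0_sym)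
    then show "x \<in> N_space \<P>"
      by (auto simp: N_space_def orth_compl_def cinner_eq_0_sym)
  qed
  also have "\<dots> \<longleftrightarrow> (\<forall>p\<in>\<P>. \<forall>\<alpha> \<beta>.
      cinner x (word_op UNIV creation \<alpha> (ncpoly_creation p (word_op UNIV creation \<beta> (ket [])))) = 0)"
    by (auto simp: G_def)
  finally show ?thesis
    by (simp add: word_op_creation_ket ncpoly_creation_def word_op_creation_sum
        word_op_creation_linear cinner_sum_right cinner_scaleC_right)
qed

text \<open>Removing an outer letter amounts to lengthening \<open>\<alpha>\<close> or
  \<open>\<beta>\<close> in the coefficient criterion.\<close>

lemma annihilation_N_space:
  assumes "x \<in> N_space \<P>"
  shows "annihilation i x \<in> N_space \<P>" "right_annihilation j x \<in> N_space \<P>"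
  unfolding N_space_iff
proof (safe, goal_cases)
  case (1 p \<alpha> \<beta>)
  then show ?case using assms[unfolded N_space_iff, rule_format, of p "i # \<alpha>" \<beta>] by simp
next
  case (2 p \<alpha> \<beta>)
  then show ?case using assms[unfolded N_space_iff, rule_format, of p \<alpha> "\<beta> @ [j]"] by simp
qed

abbreviation (input) N_proj :: "'n ncpoly set \<Rightarrow> 'n fock \<Rightarrow> 'n fock" where
  "N_proj \<P> \<equiv> orth_proj (N_space \<P>)"

lemmas N_proj_in = orth_proj(1)[OF subspace_N_space closed_N_space]
lemmas N_proj_cinner = orth_proj_cinner[OF subspace_N_space closed_N_space]
lemmas N_proj_linear = bounded_linear_orth_proj[OF subspace_N_space closed_N_space]
lemmas N_space_closed_ops = ell2.subspace_0[OF subspace_N_space] ell2.subspace_add[OF subspace_N_space]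
  ell2.subspace_scale[OF subspace_N_space]

lemma N_space_eqI:
  "x \<in> N_space \<P> \<Longrightarrow> y \<in> N_space \<P> \<Longrightarrow> (\<And>z. z \<in> N_space \<P> \<Longrightarrow> cinner x z = cinner y z) \<Longrightarrow> x = y"
  by (rule eq_on_subspaceI[OF subspace_N_space])

lemma B_op_bounded_ops: "B_op \<P> i \<in> bounded_ops (N_space \<P>)"
proof -
  obtain K where K: "\<And>x. norm (N_proj \<P> x) \<le> norm x * K"
    using bounded_linear.bounded[OF N_proj_linear(1)] by blast
  have "norm (N_proj \<P> (creation i x)) \<le> K * norm x" for x
    using K[of "creation i x"] by (simp add: norm_creation mult.commute)
  then show ?thesis
    by (auto simp: bounded_ops_def B_op_def N_space_closed_ops N_proj_in creation_linear N_proj_linear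
        linear_add[OF bounded_linear.linear[OF N_proj_linear(1)]])
qed

lemma cinner_vacuum_z:
  fixes \<mu> :: "complex ^ 'n::finite"
  assumes "norm \<mu> < 1" shows "cinner (ket []) (z_vec \<mu>) = 1"
  by (subst cinner_commute) (simp add: coord_z_vec[OF assms] word_eval_def)

text \<open>Equivalently, \<open>z_vec \<mu>\<close> is an eigenvector of the adjoint of
  \<open>T\<close> on \<open>N_space\<close>. For the generators this holds because
  \<open>z_vec \<mu>\<close> lies in \<open>N_space\<close> and is an eigenvector of the adjoint of
  every \<open>creation i\<close>; the property survives sums, products, multiples and weak-star
  limits.\<close>

lemma variety_algebra_multiplicative:
  fixes \<P> :: "'n::finite ncpoly set"
  assumes P: "\<forall>p\<in>\<P>. ncpoly_eval p 0 = 0" and T: "T \<in> variety_algebra \<P>"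
    and \<mu>: "\<mu> \<in> scalar_variety \<P>" and y: "y \<in> N_space \<P>"
  shows "cinner (T y) (z_vec \<mu>) = cinner (T (ket [])) (z_vec \<mu>) * cinner y (z_vec \<mu>)"
proof -
  let ?N = "N_space \<P>" and ?z = "z_vec \<mu>"
  note vac = vacuum_in_N_space[OF P]
  have lt: "norm \<mu> < 1" using \<mu> by (simp add: scalar_variety_def)
  \<comment> \<open>The factor <y, z> is moved inside \<open>T\<close>, so that the condition
    equates two matrix coefficients of \<open>T\<close>, as \<open>closedin_weak_star_Ball\<close>
    requires.\<close>
  define \<A> where "\<A> = {T \<in> bounded_ops ?N. \<forall>y\<in>?N. cinner (T y) ?z = cinner (T (cinner y ?z *\<^sub>C ket [])) ?z}"
  have \<A>: "T \<in> \<A> \<longleftrightarrow> T \<in> bounded_ops ?N \<and>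
      (\<forall>y\<in>?N. cinner (T y) ?z = cinner (T (ket [])) ?z * cinner y ?z)" for T
    using vac by (auto simp: \<A>_def bounded_opsD cinner_scaleC_left mult.commute)
  then have \<A>_eq: "\<A> = {T \<in> bounded_ops ?N.
      \<forall>y\<in>?N. cinner (T y) ?z = cinner (T (ket [])) ?z * cinner y ?z}" by blast
  have "variety_algebra \<P> \<subseteq> \<A>"
    unfolding variety_algebra_def
  proof (rule weak_star_algebra_subset)
    show "closedin (weak_star_topology ?N) \<A>"
      unfolding \<A>_def
      by (rule closedin_weak_star_Ball[OF subspace_N_space])
        (auto simp: z_vec_in_N_space[OF \<mu>] vac N_space_closed_ops)
    show "range (B_op \<P>) \<subseteq> \<A>"
      by (auto simp: \<A> B_op_bounded_ops)
        (auto simp: B_op_def N_proj_cinner z_vec_in_N_space[OF \<mu>] vac cinner_creation_z[OF lt]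
          cinner_vacuum_z[OF lt])
    show "unital_subalgebra ?N \<A>"
      unfolding \<A>_eq
    proof (rule unital_subalgebra_Collect[OF subspace_N_space])
      fix S T assume ST: "S \<in> bounded_ops ?N" "T \<in> bounded_ops ?N"
        "\<forall>y\<in>?N. cinner (S y) ?z = cinner (S (ket [])) ?z * cinner y ?z"
        "\<forall>y\<in>?N. cinner (T y) ?z = cinner (T (ket [])) ?z * cinner y ?z"
      show "\<forall>y\<in>?N. cinner (compose ?N S T y) ?z = cinner (compose ?N S T (ket [])) ?z * cinner y ?z"
      proof
        fix y assume y: "y \<in> ?N"
        have "cinner (S (T x)) ?z = cinner (S (ket [])) ?z * cinner (T x) ?z" if "x \<in> ?N" for x
          using ST(3) bounded_opsD(1)[OF ST(2) that] by blast
        moreover have "cinner (T y) ?z = cinner (T (ket [])) ?z * cinner y ?z"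
          using ST(4) y by blast
        ultimately show "cinner (compose ?N S T y) ?z = cinner (compose ?N S T (ket [])) ?z * cinner y ?z"
          using y vac by (simp only: compose_def restrict_apply' mult.assoc)
      qed
    next
      fix S T assume ST: "\<forall>y\<in>?N. cinner (S y) ?z = cinner (S (ket [])) ?z * cinner y ?z"
        "\<forall>y\<in>?N. cinner (T y) ?z = cinner (T (ket [])) ?z * cinner y ?z"
      show "\<forall>y\<in>?N. cinner ((\<lambda>x\<in>?N. S x + T x) y) ?z
          = cinner ((\<lambda>x\<in>?N. S x + T x) (ket [])) ?z * cinner y ?z"
      proof
        fix y assume y: "y \<in> ?N"
        show "cinner ((\<lambda>x\<in>?N. S x + T x) y) ?z
          = cinner ((\<lambda>x\<in>?N. S x + T x) (ket [])) ?z * cinner y ?z"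
          using bspec[OF ST(1) y] bspec[OF ST(2) y] y vac
          by (simp only: restrict_apply' cinner_add_left distrib_right)
      qed
    next
      fix c T assume T: "\<forall>y\<in>?N. cinner (T y) ?z = cinner (T (ket [])) ?z * cinner y ?z"
      show "\<forall>y\<in>?N. cinner ((\<lambda>x\<in>?N. c *\<^sub>C T x) y) ?z
          = cinner ((\<lambda>x\<in>?N. c *\<^sub>C T x) (ket [])) ?z * cinner y ?z"
      proof
        fix y assume y: "y \<in> ?N"
        show "cinner ((\<lambda>x\<in>?N. c *\<^sub>C T x) y) ?z
          = cinner ((\<lambda>x\<in>?N. c *\<^sub>C T x) (ket [])) ?z * cinner y ?z"
          using bspec[OF T y] y vac by (simp only: restrict_apply' cinner_scaleC_left mult.assoc)
      qed
    qed (simp add: vac cinner_vacuum_z[OF lt])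
  qed
  then show ?thesis using T y \<A> by auto
qed

text \<open>Commuting with the compressed right creation operators is a weak-star closed algebraic
  condition. The generators satisfy it because left and right annihilation commute and both leave
  \<open>N_space\<close> invariant.\<close>

lemma variety_algebra_right_creation:
  assumes T: "T \<in> variety_algebra \<P>"
  shows "T \<in> bounded_ops (N_space \<P>)"
    and "x \<in> N_space \<P> \<Longrightarrow> T (N_proj \<P> (right_creation j x)) = N_proj \<P> (right_creation j (T x))"
proof -
  let ?N = "N_space \<P>"
  \<comment> \<open>Commutation is tested against \<open>y\<close>, with the right shift moved onto
    \<open>y\<close> as its adjoint, so that again only matrix coefficients of \<open>T\<close>
    occur.\<close>
  define \<A> where "\<A> = {T \<in> bounded_ops ?N. \<forall>(j, x, y)\<in>UNIV \<times> ?N \<times> ?N.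
      cinner (T (N_proj \<P> (right_creation j x))) y = cinner (T x) (right_annihilation j y)}"
  have \<A>: "T \<in> \<A> \<longleftrightarrow> T \<in> bounded_ops ?N \<and> (\<forall>j. \<forall>x\<in>?N.
      T (N_proj \<P> (right_creation j x)) = N_proj \<P> (right_creation j (T x)))" for T
  proof (intro iffI conjI allI ballI)
    fix j x assume "T \<in> \<A>" and x: "x \<in> ?N"
    then have T: "T \<in> bounded_ops ?N" "\<And>y. y \<in> ?N \<Longrightarrow>
        cinner (T (N_proj \<P> (right_creation j x))) y = cinner (T x) (right_annihilation j y)"
      by (auto simp: \<A>_def)
    show "T (N_proj \<P> (right_creation j x)) = N_proj \<P> (right_creation j (T x))"
      by (rule N_space_eqI[where \<P> = \<P>])
        (simp_all add: T bounded_opsD(1)[OF T(1)] N_proj_in N_proj_cinner cinner_right_creation)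
  next
    assume "T \<in> bounded_ops ?N \<and> (\<forall>j. \<forall>x\<in>?N.
      T (N_proj \<P> (right_creation j x)) = N_proj \<P> (right_creation j (T x)))"
    then show "T \<in> \<A>"
      by (simp add: \<A>_def N_proj_cinner cinner_right_creation)
  qed (simp add: \<A>_def)
  then have \<A>_eq: "\<A> = {T \<in> bounded_ops ?N. \<forall>j. \<forall>x\<in>?N.
      T (N_proj \<P> (right_creation j x)) = N_proj \<P> (right_creation j (T x))}" by blast
  have add: "N_proj \<P> (right_creation j (x + y))
      = N_proj \<P> (right_creation j x) + N_proj \<P> (right_creation j y)" for j x y
    by (rule N_space_eqI[where \<P> = \<P>])
      (simp_all add: N_proj_in N_space_closed_ops N_proj_cinner cinner_right_creation cinner_add_left)
  have scale: "N_proj \<P> (right_creation j (c *\<^sub>C x)) = c *\<^sub>C N_proj \<P> (right_creation j x)" for j c x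
    by (rule N_space_eqI[where \<P> = \<P>])
      (simp_all add: N_proj_in N_space_closed_ops N_proj_cinner cinner_right_creation cinner_scaleC_left)
  have "variety_algebra \<P> \<subseteq> \<A>"
    unfolding variety_algebra_def
  proof (rule weak_star_algebra_subset)
    have "closedin (weak_star_topology ?N) {T \<in> bounded_ops ?N. \<forall>t\<in>UNIV \<times> ?N \<times> ?N.
        cinner (T (case t of (j, x, y) \<Rightarrow> N_proj \<P> (right_creation j x))) (case t of (j, x, y) \<Rightarrow> y)
        = cinner (T (case t of (j, x, y) \<Rightarrow> x)) (case t of (j, x, y) \<Rightarrow> right_annihilation j y)}"
      by (rule closedin_weak_star_Ball[OF subspace_N_space])
        (auto simp: N_proj_in annihilation_N_space)
    then show "closedin (weak_star_topology ?N) \<A>"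
      by (simp add: \<A>_def case_prod_unfold)
    show "range (B_op \<P>) \<subseteq> \<A>"
      unfolding \<A>_def
      by (auto simp: B_op_bounded_ops)
        (auto simp: B_op_def N_proj_in N_proj_cinner annihilation_N_space cinner_creation
          cinner_right_creation annihilation_right_annihilation)
    show "unital_subalgebra ?N \<A>"
      unfolding \<A>_eq
    proof (rule unital_subalgebra_Collect[OF subspace_N_space], goal_cases)
      case (3 S T)
      then show ?case by (simp add: compose_def N_proj_in bounded_opsD(1)[where T = T])
    qed (simp_all add: N_proj_in add scale)
  qed
  then show "T \<in> bounded_ops ?N"
    "x \<in> ?N \<Longrightarrow> T (N_proj \<P> (right_creation j x)) = N_proj \<P> (right_creation j (T x))"
    using T \<A> by auto
qed

text \<open>The vacuum is cyclic for the compressed right creation operators, which commute with \<open>T\<close>.\<close>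

lemma variety_algebra_fix_vacuum:
  assumes T: "T \<in> variety_algebra \<P>" and vac: "ket [] \<in> N_space \<P>" "T (ket []) = ket []"
    and x: "x \<in> N_space \<P>"
  shows "T x = x"
proof -
  let ?N = "N_space \<P>"
  note bT = variety_algebra_right_creation(1)[OF T]
  have ket: "T (N_proj \<P> (ket \<alpha>)) = N_proj \<P> (ket \<alpha>)" for \<alpha>
  proof (induction \<alpha> rule: rev_induct)
    case Nil
    then show ?case using vac by (simp add: N_proj_linear)
  next
    case (snoc j \<alpha>)
    \<comment> \<open>The inner projection can be inserted since \<open>right_annihilation j\<close>
      maps \<open>N_space\<close> into itself.\<close>
    have "N_proj \<P> (ket (\<alpha> @ [j])) = N_proj \<P> (right_creation j (N_proj \<P> (ket \<alpha>)))"
      by (rule N_space_eqI[where \<P> = \<P>]) (simp_all add: N_proj_in N_proj_cinner cinner_right_creation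
          annihilation_N_space flip: right_creation_ket del: cinner_ket_right)
    then show ?case
      by (simp add: variety_algebra_right_creation(2)[OF T] N_proj_in snoc)
  qed
  obtain K where K: "K \<ge> 0" "\<And>x. x \<in> ?N \<Longrightarrow> norm (T x) \<le> K * norm x"
    using bounded_ops_bound[OF bT] by blast
  obtain L where L: "\<And>x. norm (N_proj \<P> x) \<le> norm x * L"
    using bounded_linear.bounded[OF N_proj_linear(1)] by blast
  interpret P: bounded_linear "N_proj \<P>" by (rule N_proj_linear(1))
  \<comment> \<open>\<open>T\<close> is controlled only on \<open>N_space\<close>; precomposing with
    the projection gives a bounded linear map on the whole Fock space, to which the basis expansion
    applies.\<close>
  interpret D: bounded_linear "\<lambda>x. T (N_proj \<P> x)"
  proof (rule bounded_linear_intro[where K = "K * L"])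
    show "T (N_proj \<P> (x + y)) = T (N_proj \<P> x) + T (N_proj \<P> y)" for x y
      by (simp add: P.add bounded_opsD[OF bT] N_proj_in)
    show "T (N_proj \<P> (r *\<^sub>R x)) = r *\<^sub>R T (N_proj \<P> x)" for r x
      by (simp add: scaleR_scaleC N_proj_linear bounded_opsD[OF bT] N_proj_in)
    show "norm (T (N_proj \<P> x)) \<le> norm x * (K * L)" for x
      using K(2)[OF N_proj_in, of x] mult_left_mono[OF L[of x] K(1)] by (simp add: mult_ac)
  qed
  have "((\<lambda>\<alpha>. T (N_proj \<P> (coord x \<alpha> *\<^sub>C ket \<alpha>))) has_sum T (N_proj \<P> x)) UNIV"
    by (rule has_sum_bounded_linear[OF D.bounded_linear_axioms ell2_has_sum_ket, unfolded o_def])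
  moreover have "((\<lambda>\<alpha>. N_proj \<P> (coord x \<alpha> *\<^sub>C ket \<alpha>)) has_sum N_proj \<P> x) UNIV"
    by (rule has_sum_bounded_linear[OF P.bounded_linear_axioms ell2_has_sum_ket, unfolded o_def])
  ultimately have "T (N_proj \<P> x) = N_proj \<P> x"
    by (simp add: N_proj_linear bounded_opsD[OF bT] N_proj_in ket has_sum_unique)
  then show ?thesis using x by (simp add: N_proj_linear)
qed

section \<open>The Gram estimate for the orbit of the vacuum\<close>

section \<open>Row contractions with a vacuum vector\<close>

text \<open>The scalar core of \<open>vacuum_step\<close>: a weighted Young inequality.\<close>

lemma vacuum_step_real:
  fixes r D S q :: real
  assumes r: "0 \<le> r" "r < 1" and S: "S\<^sup>2 \<le> r\<^sup>2 * q" and "0 \<le> D" "0 \<le> S"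
  shows "(1 + r) * (D + S)\<^sup>2 - S\<^sup>2 \<le> (1 + r) / (1 - r) * D\<^sup>2 + r * q"
proof (cases "r = 0")
  case True
  then show ?thesis using S by simp
next
  case False
  \<comment> \<open>The numbers 1 - r and r sum to 1, so the defect is a perfect square. After
    multiplication by 1 + r the second term is S^2/r + S^2: the last summand cancels the subtracted
    square, and the hypothesis bounds S^2/r by r q.\<close>
  have "(D + S)\<^sup>2 + (r * D - (1 - r) * S)\<^sup>2 / (r * (1 - r)) = D\<^sup>2 / (1 - r) + S\<^sup>2 / r"
    using False r by (simp add: field_simps) algebra
  moreover have "0 \<le> (r * D - (1 - r) * S)\<^sup>2 / (r * (1 - r))"
    using r by simp
  ultimately have "(D + S)\<^sup>2 \<le> D\<^sup>2 / (1 - r) + S\<^sup>2 / r" by linarith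
  then have "(1 + r) * (D + S)\<^sup>2 \<le> (1 + r) * (D\<^sup>2 / (1 - r) + S\<^sup>2 / r)"
    using r by (intro mult_left_mono) auto
  also have "\<dots> = (1 + r) / (1 - r) * D\<^sup>2 + S\<^sup>2 / r + S\<^sup>2"
    using False r by (simp add: field_simps)
  also have "S\<^sup>2 / r \<le> r * q"
    using S False r by (simp add: field_simps power2_eq_square)
  finally show ?thesis by simp
qed

text \<open>Isolates what the norm estimates use: \<open>v\<close> is a common eigenvector of the
  adjoints of the entries of a row contraction, with eigenvalues conjugate to the entries of
  \<open>a\<close>. In the application \<open>v\<close> is the vacuum and \<open>a\<close> is the
  symbol value at the origin.\<close>

locale vacuum_row_contraction =
  fixes N :: "'a ell2 set" and \<psi> :: "'n::finite \<Rightarrow> 'a ell2 \<Rightarrow> 'a ell2"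
    and v :: "'a ell2" and a :: "complex ^ 'n"
  assumes subspace: "ell2.subspace N" and closed: "closed N"
    and ops: "\<psi> i \<in> bounded_ops N"
    and contraction: "(\<And>i. y i \<in> N) \<Longrightarrow> (norm (\<Sum>i\<in>UNIV. \<psi> i (y i)))\<^sup>2 \<le> (\<Sum>i\<in>UNIV. (norm (y i))\<^sup>2)"
    and vacuum: "v \<in> N" "norm v = 1"
    and eigen: "x \<in> N \<Longrightarrow> cinner (\<psi> i x) v = a $ i * cinner x v"
    and norm_a: "norm a < 1"
begin

text \<open>A bound for the Gram operator of the vectors \<open>orbit \<alpha>\<close>; its square
  root is the constant of the upper norm estimate.\<close>

definition gram_const :: real where
  "gram_const = (1 + norm a) / (1 - norm a)"

definition orbit :: "'n list \<Rightarrow> 'a ell2" where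
  "orbit \<alpha> = word_op N \<psi> \<alpha> v"

lemma gram_const_nonneg: "0 \<le> gram_const"
  using norm_a by (simp add: gram_const_def)

lemmas N_closed = ell2.subspace_0[OF subspace] ell2.subspace_add[OF subspace]
  ell2.subspace_scale[OF subspace] ell2.subspace_sum[OF subspace]

lemmas \<psi>_simps = bounded_opsD(1-3)[OF ops]

lemma orbit_simps [simp]: "orbit [] = v" "orbit (i # \<alpha>) = \<psi> i (orbit \<alpha>)"
  using vacuum(1) by (simp_all add: orbit_def compose_def)

lemma orbit_in: "orbit \<alpha> \<in> N"
  by (induction \<alpha>) (simp_all add: vacuum \<psi>_simps)

lemma \<psi>_sum:
  assumes "\<And>j. j \<in> J \<Longrightarrow> x j \<in> N"
  shows "\<psi> i (\<Sum>j\<in>J. c j *\<^sub>C x j) = (\<Sum>j\<in>J. c j *\<^sub>C \<psi> i (x j))"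
proof -
  have "\<psi> i 0 = 0" using \<psi>_simps(3)[OF vacuum(1), of i 0] by simp
  with assms show ?thesis
    by (induction J rule: infinite_finite_induct) (simp_all add: \<psi>_simps N_closed)
qed

text \<open>
  The weight \<open>norm a\<close> of the second term is the one for which this estimate reproduces itself
  under iteration with the smallest possible constant.
\<close>

lemma vacuum_step:
  fixes d :: complex
  assumes y: "\<And>i. y i \<in> N"
  defines "F \<equiv> d *\<^sub>C v + (\<Sum>i\<in>UNIV. \<psi> i (y i))"
  shows "(norm F)\<^sup>2 + norm a * (cmod (cinner F v))\<^sup>2
    \<le> gram_const * (cmod d)\<^sup>2 + (\<Sum>i\<in>UNIV. (norm (y i))\<^sup>2 + norm a * (cmod (cinner (y i) v))\<^sup>2)"
proof -
  define Y where "Y = (\<Sum>i\<in>UNIV. \<psi> i (y i))"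
  define s where "s = (\<Sum>i\<in>UNIV. a $ i * cinner (y i) v)"
  define q where "q = (\<Sum>i\<in>UNIV. (cmod (cinner (y i) v))\<^sup>2)"
  have s: "cinner Y v = s" "cinner v Y = cnj s"
    using y by (subst cinner_commute; simp add: Y_def s_def cinner_sum_left eigen)+
  have v: "cinner v v = 1" using vacuum by (simp add: cinner_self_norm)
  have "cmod s \<le> (\<Sum>i\<in>UNIV. \<bar>cmod (a $ i)\<bar> * \<bar>cmod (cinner (y i) v)\<bar>)"
    unfolding s_def by (rule order_trans[OF norm_sum]) (simp add: norm_mult)
  also have "\<dots> \<le> norm a * sqrt q"
    unfolding norm_vec_def q_def
    using L2_set_mult_ineq[where f = "\<lambda>i. cmod (a $ i)" and g = "\<lambda>i. cmod (cinner (y i) v)"]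
    by (simp add: L2_set_def)
  finally have "(cmod s)\<^sup>2 \<le> (norm a * sqrt q)\<^sup>2" by (rule power_mono) simp
  then have S: "(cmod s)\<^sup>2 \<le> (norm a)\<^sup>2 * q"
    by (simp add: power_mult_distrib q_def sum_nonneg)
  have F: "(norm F)\<^sup>2 = (cmod d)\<^sup>2 + 2 * Re (d * cnj s) + (norm Y)\<^sup>2"
    unfolding F_def Y_def[symmetric]
    by (simp add: norm_add_sq norm_scaleC vacuum cinner_scaleC_left s)
  have Fv: "cinner F v = d + s"
    unfolding F_def Y_def[symmetric] by (simp add: cinner_add_left cinner_scaleC_left s v)
  have ds: "(cmod (d + s))\<^sup>2 = (cmod d)\<^sup>2 + 2 * Re (d * cnj s) + (cmod s)\<^sup>2"
    unfolding cmod_power2 by (simp add: power2_eq_square algebra_simps)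
  \<comment> \<open>The cross term 2 Re(d cnj s) occurs both in |F|^2 and in |<F, v>|^2; it is
    absorbed into |d + s|^2, at the price of -|s|^2.\<close>
  have "(norm F)\<^sup>2 + norm a * (cmod (cinner F v))\<^sup>2
      = (1 + norm a) * (cmod (d + s))\<^sup>2 - (cmod s)\<^sup>2 + (norm Y)\<^sup>2"
    unfolding F Fv ds by (simp add: algebra_simps)
  also have "\<dots> \<le> (1 + norm a) * (cmod d + cmod s)\<^sup>2 - (cmod s)\<^sup>2 + (\<Sum>i\<in>UNIV. (norm (y i))\<^sup>2)"
    using contraction[OF y]
    by (intro add_mono diff_mono mult_left_mono power_mono norm_triangle_ineq) (auto simp: Y_def)
  also have "\<dots> \<le> gram_const * (cmod d)\<^sup>2 + norm a * q + (\<Sum>i\<in>UNIV. (norm (y i))\<^sup>2)"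
    unfolding gram_const_def using vacuum_step_real[OF _ norm_a S] by simp
  finally show ?thesis
    by (simp add: q_def sum.distrib sum_distrib_left)
qed

text \<open>Induction on the length bound, peeling off first letters. Keeping the weighted vacuum
  term on the left lets \<open>vacuum_step\<close> consume it, so the constant does not grow with
  \<open>m\<close>.\<close>

lemma gram_bound_less:
  fixes c :: "'n list \<Rightarrow> complex" and m :: nat
  defines "F \<equiv> \<Sum>\<alpha> | length \<alpha> < m. c \<alpha> *\<^sub>C orbit \<alpha>"
  shows "(norm F)\<^sup>2 + norm a * (cmod (cinner F v))\<^sup>2
    \<le> gram_const * (\<Sum>\<alpha> | length \<alpha> < m. (cmod (c \<alpha>))\<^sup>2)"
  unfolding F_def
proof (induction m arbitrary: c)
  case (Suc m)
  define y where "y i = (\<Sum>\<beta> | length \<beta> < m. c (i # \<beta>) *\<^sub>C orbit \<beta>)" for i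
  have y: "y i \<in> N" for i
    unfolding y_def by (intro N_closed orbit_in)
  have F: "(\<Sum>\<alpha> | length \<alpha> < Suc m. c \<alpha> *\<^sub>C orbit \<alpha>) = c [] *\<^sub>C v + (\<Sum>i\<in>UNIV. \<psi> i (y i))"
    unfolding sum_words_less_Suc y_def by (simp add: \<psi>_sum orbit_in)
  have "(\<Sum>i\<in>UNIV. (norm (y i))\<^sup>2 + norm a * (cmod (cinner (y i) v))\<^sup>2)
      \<le> (\<Sum>i\<in>UNIV. gram_const * (\<Sum>\<beta> | length \<beta> < m. (cmod (c (i # \<beta>)))\<^sup>2))"
    unfolding y_def by (intro sum_mono Suc.IH)
  with vacuum_step[of y "c []", OF y] show ?case
    unfolding F sum_words_less_Suc by (simp add: distrib_left sum_distrib_left)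
qed simp

text \<open>Coefficients are extended by zero to all words shorter than \<open>m\<close>, and the
  weighted vacuum term is dropped.\<close>

lemma gram_bound:
  assumes "finite A"
  shows "(norm (\<Sum>\<alpha>\<in>A. c \<alpha> *\<^sub>C orbit \<alpha>))\<^sup>2 \<le> gram_const * (\<Sum>\<alpha>\<in>A. (cmod (c \<alpha>))\<^sup>2)"
proof -
  define m where "m = Suc (Max (insert 0 (length ` A)))"
  define c' where "c' \<alpha> = (if \<alpha> \<in> A then c \<alpha> else 0)" for \<alpha>
  have A: "A \<subseteq> {\<alpha>. length \<alpha> < m}"
    using assms by (auto simp: m_def less_Suc_eq_le intro!: Max_ge)
  have e: "(\<Sum>\<alpha>\<in>A. c \<alpha> *\<^sub>C orbit \<alpha>) = (\<Sum>\<alpha> | length \<alpha> < m. c' \<alpha> *\<^sub>C orbit \<alpha>)"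
    "(\<Sum>\<alpha>\<in>A. (cmod (c \<alpha>))\<^sup>2) = (\<Sum>\<alpha> | length \<alpha> < m. (cmod (c' \<alpha>))\<^sup>2)"
    using A by (intro sum.mono_neutral_cong_left; auto simp: c'_def finite_words_less)+
  show ?thesis
    unfolding e using gram_bound_less[where m = m and c = c'] by (smt (verit) mult_nonneg_nonneg norm_ge_zero zero_le_power2)
qed

section \<open>Convergence and norm of the composition series\<close>

definition comp_term :: "'n fock \<Rightarrow> nat \<Rightarrow> 'a ell2" where
  "comp_term x k = (\<Sum>\<alpha> | length \<alpha> = k. coord x \<alpha> *\<^sub>C orbit \<alpha>)"

definition composition :: "'n fock \<Rightarrow> 'a ell2" where
  "composition x = suminf (comp_term x)"

lemma comp_term_sum:
  assumes "finite J"
  shows "(norm (\<Sum>k\<in>J. comp_term x k))\<^sup>2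
    \<le> gram_const * (\<Sum>k\<in>J. \<Sum>\<alpha> | length \<alpha> = k. (cmod (coord x \<alpha>))\<^sup>2)"
proof -
  have u: "(\<Sum>k\<in>J. \<Sum>\<alpha> | length \<alpha> = k. f \<alpha>) = (\<Sum>\<alpha>\<in>(\<Union>k\<in>J. {\<alpha>. length \<alpha> = k}). f \<alpha>)"
    for f :: "'n list \<Rightarrow> 'b::comm_monoid_add"
    using assms by (intro sum.UNION_disjoint[symmetric]) (auto intro!: finite_words)
  show ?thesis
    unfolding comp_term_def u by (rule gram_bound) (use assms in \<open>auto intro!: finite_words\<close>)
qed

lemma summable_comp_term: "summable (comp_term x)"
  unfolding summable_Cauchy
proof (intro allI impI)
  fix e :: real assume e: "e > 0"
  let ?b = "\<lambda>k. \<Sum>\<alpha> | length \<alpha> = k. (cmod (coord x \<alpha>))\<^sup>2"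
  have "summable ?b"
    using has_sum_words_sums[OF has_sum_infsum[OF coord_summable[of x UNIV]]] by (rule sums_summable)
  \<comment> \<open>The \<open>+ 1\<close> makes the divisor positive by
    \<open>gram_const_nonneg\<close> alone.\<close>
  moreover have "0 < e\<^sup>2 / (gram_const + 1)" using e gram_const_nonneg by simp
  ultimately obtain M where M: "\<And>m n. m \<ge> M \<Longrightarrow> norm (sum ?b {m..<n}) < e\<^sup>2 / (gram_const + 1)"
    unfolding summable_Cauchy by blast
  have "norm (sum (comp_term x) {m..<n}) < e" if "m \<ge> M" for m n
  proof (rule power2_less_imp_less)
    have "(norm (sum (comp_term x) {m..<n}))\<^sup>2 \<le> gram_const * sum ?b {m..<n}"
      by (rule comp_term_sum) simp
    also have "\<dots> \<le> (gram_const + 1) * norm (sum ?b {m..<n})"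
      using gram_const_nonneg by (intro mult_mono) (auto intro!: sum_nonneg)
    also have "\<dots> < e\<^sup>2"
      using M[OF that, of n] gram_const_nonneg by (simp add: field_simps)
    finally show "(norm (sum (comp_term x) {m..<n}))\<^sup>2 < e\<^sup>2" .
  qed (use e in simp)
  then show "\<exists>M. \<forall>m\<ge>M. \<forall>n. norm (sum (comp_term x) {m..<n}) < e" by blast
qed

lemma composition_in: "composition x \<in> N"
proof (rule closed_sequentially[OF closed])
  show "(\<lambda>n. \<Sum>k<n. comp_term x k) \<longlonglongrightarrow> composition x"
    using summable_comp_term unfolding composition_def by (rule summable_LIMSEQ)
qed (simp add: comp_term_def N_closed orbit_in)

lemma norm_composition: "norm (composition x) \<le> sqrt gram_const * norm x"
proof (rule tendsto_upperbound)
  show "(\<lambda>n. norm (\<Sum>k<n. comp_term x k)) \<longlonglongrightarrow> norm (composition x)"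
    using summable_LIMSEQ[OF summable_comp_term] unfolding composition_def by (intro tendsto_norm)
  have "norm (\<Sum>k<n. comp_term x k) \<le> sqrt gram_const * norm x" for n
  proof (rule power2_le_imp_le)
    have "(norm (\<Sum>k<n. comp_term x k))\<^sup>2
        \<le> gram_const * (\<Sum>k<n. \<Sum>\<alpha> | length \<alpha> = k. (cmod (coord x \<alpha>))\<^sup>2)"
      by (rule comp_term_sum) simp
    also have "(\<Sum>k<n. \<Sum>\<alpha> | length \<alpha> = k. (cmod (coord x \<alpha>))\<^sup>2)
        = (\<Sum>\<alpha>\<in>(\<Union>k<n. {\<alpha>. length \<alpha> = k}). (cmod (coord x \<alpha>))\<^sup>2)"
      by (intro sum.UNION_disjoint[symmetric]) (auto intro!: finite_words)
    also have "\<dots> \<le> (norm x)\<^sup>2"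
      by (rule sum_coord_le_norm) (auto intro!: finite_words)
    finally show "(norm (\<Sum>k<n. comp_term x k))\<^sup>2 \<le> (sqrt gram_const * norm x)\<^sup>2"
      using gram_const_nonneg by (simp add: power_mult_distrib mult_left_mono)
  qed (simp add: gram_const_nonneg)
  then show "\<forall>\<^sub>F n in sequentially. norm (\<Sum>k<n. comp_term x k) \<le> sqrt gram_const * norm x"
    by simp
qed simp


text \<open>The adjoint of \<open>composition\<close>, as a map into the full Fock space. That the
  family is square summable, so that \<open>Abs_ell2\<close> is meaningful, is proved in
  \<open>coord_coeff\<close>.\<close>

definition coeff :: "'a ell2 \<Rightarrow> 'n fock" where
  "coeff g = Abs_ell2 (\<lambda>\<alpha>. cinner g (orbit \<alpha>))"

text \<open>The dual of \<open>gram_bound\<close>: pairing \<open>g\<close> with the combination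
  \<open>y\<close> weighted by its own coefficients gives S = <g, y>, hence S^2 is at most |g|^2
  times \<open>gram_const\<close> times S.\<close>

lemma coeff_bound:
  assumes "finite A"
  shows "(\<Sum>\<alpha>\<in>A. (cmod (cinner g (orbit \<alpha>)))\<^sup>2) \<le> gram_const * (norm g)\<^sup>2"
proof -
  define S where "S = (\<Sum>\<alpha>\<in>A. (cmod (cinner g (orbit \<alpha>)))\<^sup>2)"
  have "S \<ge> 0" by (simp add: S_def sum_nonneg)
  define y where "y = (\<Sum>\<alpha>\<in>A. cinner g (orbit \<alpha>) *\<^sub>C orbit \<alpha>)"
  have "complex_of_real S = cinner g y"
    by (simp add: S_def y_def cinner_sum_right cinner_scaleC_right complex_norm_square mult.commute
        del: of_real_power)
  then have "S = cmod (cinner g y)" using \<open>S \<ge> 0\<close> by (metis abs_of_nonneg norm_of_real)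
  then have "S\<^sup>2 \<le> (norm g * norm y)\<^sup>2"
    using cinner_Cauchy_Schwarz[of g y] by (intro power_mono) auto
  also have "\<dots> \<le> (norm g)\<^sup>2 * (gram_const * S)"
    unfolding power_mult_distrib S_def y_def by (intro mult_left_mono gram_bound assms) simp
  finally have "S * S \<le> (gram_const * (norm g)\<^sup>2) * S" by (simp add: power2_eq_square mult_ac)
  then have "S \<le> gram_const * (norm g)\<^sup>2 \<or> S = 0"
    using \<open>S \<ge> 0\<close> by (metis mult_right_le_imp_le order_le_less)
  then show ?thesis
    unfolding S_def[symmetric] using gram_const_nonneg by auto
qed

lemma coord_coeff: "coord (coeff g) \<alpha> = cinner g (orbit \<alpha>)"
proof -
  have "(\<lambda>\<alpha>. (cmod (cinner g (orbit \<alpha>)))\<^sup>2) summable_on UNIV"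
    by (rule nonneg_bdd_above_summable_on)
      (auto intro!: bdd_aboveI[of _ "gram_const * (norm g)\<^sup>2"] coeff_bound)
  then show ?thesis by (simp add: coeff_def Abs_ell2_inverse)
qed

lemma norm_coeff: "norm (coeff g) \<le> sqrt gram_const * norm g"
proof -
  have "(\<Sum>\<^sub>\<infinity>\<alpha>. (cmod (coord (coeff g) \<alpha>))\<^sup>2) \<le> gram_const * (norm g)\<^sup>2"
    by (rule infsum_le_finite_sums[OF coord_summable]) (simp add: coord_coeff coeff_bound)
  then have "norm (coeff g) \<le> sqrt (gram_const * (norm g)\<^sup>2)"
    unfolding norm_ell2_eq[of "coeff g"] by (rule real_sqrt_le_mono)
  then show ?thesis by (simp add: real_sqrt_mult)
qed

lemma coeff_linear: "coeff (x + y) = coeff x + coeff y" "coeff (c *\<^sub>C x) = c *\<^sub>C coeff x"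
  by (rule ell2_eqI; simp add: coord_coeff cinner_add_left cinner_scaleC_left)+

lemma cinner_composition: "cinner (composition x) g = cinner x (coeff g)"
proof -
  have "(\<lambda>k. cinner (comp_term x k) g) sums cinner (composition x) g"
    unfolding composition_def
    using bounded_linear.sums[OF bounded_linear_cinner_left summable_sums[OF summable_comp_term]] .
  moreover have "cinner (comp_term x k) g
      = (\<Sum>\<alpha> | length \<alpha> = k. coord x \<alpha> * cnj (coord (coeff g) \<alpha>))" for k
    by (simp add: comp_term_def cinner_sum_left cinner_scaleC_left coord_coeff flip: cinner_commute)
  moreover have "(\<lambda>k. \<Sum>\<alpha> | length \<alpha> = k. coord x \<alpha> * cnj (coord (coeff g) \<alpha>)) sums cinner x (coeff g)"
    unfolding cinner_def by (intro has_sum_words_sums has_sum_infsum ell2_prod_summable)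
  ultimately show ?thesis by (simp add: sums_unique2)
qed

text \<open>Read off from the adjoint relation, without manipulating series.\<close>

lemma composition_linear: "composition (x + y) = composition x + composition y" "composition (c *\<^sub>C x) = c *\<^sub>C composition x"
  by (rule cinner_eqI; simp add: cinner_composition cinner_add_left cinner_scaleC_left)+

end

section \<open>Suprema of quotients and uniqueness of the adjoint\<close>

section \<open>Operator norms and adjoints\<close>

text \<open>The zero vector contributes the quotient 0, as division by zero yields 0;
  \<open>K \<ge> 0\<close> covers it.\<close>

lemma op_norm_bdd_above:
  assumes "K \<ge> 0" "\<And>x. x \<in> V \<Longrightarrow> norm (T x) \<le> K * norm x"
  shows "bdd_above ((\<lambda>x. norm (T x) / norm x) ` V)"
proof (rule bdd_aboveI2)
  fix x assume "x \<in> V"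
  then show "norm (T x) / norm x \<le> K"
    using assms(1) assms(2)[of x] by (cases "x = 0") (auto simp: divide_le_eq)
qed

lemma norm_le_op_norm:
  assumes "K \<ge> 0" "\<And>x. x \<in> V \<Longrightarrow> norm (T x) \<le> K * norm x" and x: "x \<in> V"
  shows "norm (T x) \<le> op_norm V T * norm x"
proof (cases "x = 0")
  case True
  then show ?thesis using assms(2)[OF x] by simp
next
  case False
  have "norm (T x) / norm x \<le> op_norm V T"
    unfolding op_norm_def by (rule cSUP_upper[OF x op_norm_bdd_above[OF assms(1,2)]])
  then show ?thesis using False by (simp add: divide_le_eq)
qed

text \<open>On \<open>N\<close> two candidates have the same inner products; outside
  \<open>N\<close> both are \<open>undefined\<close>.\<close>

lemma adjoint_on_eqI:
  assumes N: "ell2.subspace N" and A: "A \<in> bounded_ops N"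
    and adj: "\<And>x y. x \<in> N \<Longrightarrow> y \<in> N \<Longrightarrow> cinner (T x) y = cinner x (A y)"
  shows "adjoint_on N T = A"
  unfolding adjoint_on_def
proof (rule the_equality)
  fix B assume B: "B \<in> bounded_ops N \<and> (\<forall>x\<in>N. \<forall>y\<in>N. cinner (T x) y = cinner x (B y))"
  show "B = A"
  proof
    fix y
    show "B y = A y"
    proof (cases "y \<in> N")
      case True
      show ?thesis
      proof (rule eq_on_subspaceI[OF N])
        fix z assume "z \<in> N"
        then have "cinner z (B y) = cinner z (A y)" using B adj True by metis
        then show "cinner (B y) z = cinner (A y) z" by (metis cinner_commute)
      qed (use B A True bounded_opsD(1) in auto)
    next
      case False
      then show ?thesis using B A bounded_opsD(4) by metis
    qed
  qed
qed (use A adj in auto)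

section \<open>Strictness of the norm bound for non-scalar rows\<close>

section \<open>The value at the origin\<close>

lemma unital_subalgebra_sum:
  assumes U: "unital_subalgebra N \<A>" and T: "\<And>i. i \<in> J \<Longrightarrow> T i \<in> \<A>" and "finite J"
  shows "(\<lambda>x\<in>N. \<Sum>i\<in>J. c i *\<^sub>C T i x) \<in> \<A>"
  using \<open>finite J\<close> T
proof (induction J)
  case empty
  \<comment> \<open>The zero operator arises as zero times the identity.\<close>
  have "(\<lambda>x\<in>N. 0 *\<^sub>C (\<lambda>x\<in>N. x) x) \<in> \<A>"
    using U unfolding unital_subalgebra_def by blast
  moreover have "(\<lambda>x\<in>N. 0 *\<^sub>C (\<lambda>x\<in>N. x) x) = (\<lambda>x\<in>N. \<Sum>i\<in>{}. c i *\<^sub>C T i x)" by auto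
  ultimately show ?case by (simp only:)
next
  case (insert j J)
  have "(\<lambda>x\<in>N. c j *\<^sub>C T j x) \<in> \<A>" "(\<lambda>x\<in>N. \<Sum>i\<in>J. c i *\<^sub>C T i x) \<in> \<A>"
    using U insert unfolding unital_subalgebra_def by blast+
  then have "(\<lambda>x\<in>N. (\<lambda>x\<in>N. c j *\<^sub>C T j x) x + (\<lambda>x\<in>N. \<Sum>i\<in>J. c i *\<^sub>C T i x) x) \<in> \<A>"
    using U unfolding unital_subalgebra_def by blast
  moreover have "(\<lambda>x\<in>N. (\<lambda>x\<in>N. c j *\<^sub>C T j x) x + (\<lambda>x\<in>N. \<Sum>i\<in>J. c i *\<^sub>C T i x) x)
      = (\<lambda>x\<in>N. \<Sum>i\<in>insert j J. c i *\<^sub>C T i x)"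
    using insert by (auto intro!: restrict_ext)
  ultimately show ?case by (simp only:)
qed

lemma variety_algebra_sum:
  fixes \<psi> :: "'n::finite \<Rightarrow> 'n fock \<Rightarrow> 'n fock"
  assumes "\<And>i. \<psi> i \<in> variety_algebra \<P>"
  shows "(\<lambda>x\<in>N_space \<P>. \<Sum>i\<in>UNIV. c i *\<^sub>C \<psi> i x) \<in> variety_algebra \<P>"
  using assms unfolding variety_algebra_def weak_star_algebra_def
  by (auto intro!: unital_subalgebra_sum)

lemma power2_norm_vec: "(norm (x :: 'b::real_normed_vector ^ 'n::finite))\<^sup>2 = (\<Sum>i\<in>UNIV. (norm (x $ i))\<^sup>2)"
  by (simp add: norm_vec_def L2_set_def sum_nonneg)

text \<open>\<open>op_norm\<close> is a real supremum, so it controls individual vectors only once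
  the quotients are known to be bounded; the sum of the entry bounds \<open>K i\<close> serves for
  that.\<close>

lemma row_contraction_norm_le:
  fixes \<psi> :: "'n::finite \<Rightarrow> 'n fock \<Rightarrow> 'n fock"
  assumes ops: "\<And>i. \<psi> i \<in> bounded_ops (N_space \<P>)"
    and le: "op_norm {x. \<forall>i. x $ i \<in> N_space \<P>} (row_op \<psi>) \<le> 1"
    and y: "\<And>i. y i \<in> N_space \<P>"
  shows "(norm (\<Sum>i\<in>UNIV. \<psi> i (y i)))\<^sup>2 \<le> (\<Sum>i\<in>UNIV. (norm (y i))\<^sup>2)"
proof -
  let ?V = "{x :: 'n fock ^ 'n. \<forall>i. x $ i \<in> N_space \<P>}"
  have "\<exists>K\<ge>0. \<forall>x\<in>N_space \<P>. norm (\<psi> i x) \<le> K * norm x" for i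
    using bounded_ops_bound[OF ops] by metis
  then obtain K where K: "\<And>i. K i \<ge> 0" "\<And>i x. x \<in> N_space \<P> \<Longrightarrow> norm (\<psi> i x) \<le> K i * norm x"
    by metis
  have "norm (row_op \<psi> x) \<le> (\<Sum>i\<in>UNIV. K i) * norm x" if "x \<in> ?V" for x
  proof -
    have "norm (row_op \<psi> x) \<le> (\<Sum>i\<in>UNIV. K i * norm (x $ i))"
      unfolding row_op_def using that by (intro order_trans[OF norm_sum] sum_mono K(2)) auto
    also have "\<dots> \<le> (\<Sum>i\<in>UNIV. K i * norm x)"
      by (intro sum_mono mult_left_mono K(1)) (simp add: Finite_Cartesian_Product.norm_nth_le)
    finally show ?thesis by (simp add: sum_distrib_right)
  qed
  moreover have "(\<Sum>i\<in>UNIV. K i) \<ge> 0" by (simp add: sum_nonneg K(1))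
  moreover define Y :: "'n fock ^ 'n" where "Y = (\<chi> i. y i)"
  moreover have "Y \<in> ?V" using y by (simp add: Y_def)
  ultimately have "norm (row_op \<psi> Y) \<le> op_norm ?V (row_op \<psi>) * norm Y"
    by (intro norm_le_op_norm) 
  also have "\<dots> \<le> norm Y" using mult_right_mono[OF le, of "norm Y"] by simp
  finally have "(norm (row_op \<psi> Y))\<^sup>2 \<le> (norm Y)\<^sup>2" by (rule power_mono) simp
  then show ?thesis by (simp add: power2_norm_vec Y_def row_op_def)
qed

text \<open>
  If \<open>a = \<psi>(0)\<close> were a unit vector, then \<open>T = \<Sum>i. cnj a\<^sub>i \<psi>\<^sub>i\<close> would fix the vacuum, hence \<open>T = I\<close>,
  and a row contraction with this property is the scalar row \<open>a\<close>.
\<close>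

lemma norm_symbol_value_0:
  fixes \<psi> :: "'n::finite \<Rightarrow> 'n fock \<Rightarrow> 'n fock"
  assumes P: "\<forall>p\<in>\<P>. ncpoly_eval p 0 = 0" and alg: "\<And>i. \<psi> i \<in> variety_algebra \<P>"
    and nonscalar: "\<not> (\<exists>a :: complex ^ 'n. \<forall>i. \<psi> i = (\<lambda>x\<in>N_space \<P>. (a $ i) *\<^sub>C x))"
    and contr: "\<And>y. (\<And>i. y i \<in> N_space \<P>) \<Longrightarrow>
      (norm (\<Sum>i\<in>UNIV. \<psi> i (y i)))\<^sup>2 \<le> (\<Sum>i\<in>UNIV. (norm (y i))\<^sup>2)"
  shows "norm (symbol_value \<psi> 0) < 1"
proof (rule ccontr)
  let ?N = "N_space \<P>"
  note vac = vacuum_in_N_space[OF P]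
  note ops = variety_algebra_right_creation(1)[OF alg]
  note \<psi>_simps = bounded_opsD(1-3)[OF ops]
  note sub = N_space_closed_ops
  define a where "a = symbol_value \<psi> 0"
  assume "\<not> norm (symbol_value \<psi> 0) < 1"
  then have ge: "norm a \<ge> 1" by (simp add: a_def)
  have a: "coord (\<psi> i (ket [])) [] = a $ i" for i
    by (simp add: a_def symbol_value_def z_vec_0)
  \<comment> \<open>The row applied to the conjugates of its own vacuum coefficients: contractivity
    gives |u| <= |a|, while <u, 1> = |a|^2.\<close>
  define u where "u = (\<Sum>i\<in>UNIV. cnj (a $ i) *\<^sub>C \<psi> i (ket []))"
  have "(norm u)\<^sup>2 = (norm (\<Sum>i\<in>UNIV. \<psi> i (cnj (a $ i) *\<^sub>C ket [])))\<^sup>2"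
    by (simp add: u_def \<psi>_simps vac)
  also have "\<dots> \<le> (\<Sum>i\<in>UNIV. (norm (cnj (a $ i) *\<^sub>C ket [] :: 'n fock))\<^sup>2)"
    by (rule contr) (simp add: sub vac)
  also have "\<dots> = (norm a)\<^sup>2" by (simp add: norm_scaleC power2_norm_vec)
  finally have u: "(norm u)\<^sup>2 \<le> (norm a)\<^sup>2" .
  have "coord u [] = (\<Sum>i\<in>UNIV. complex_of_real ((cmod (a $ i))\<^sup>2))"
    by (simp add: u_def a complex_norm_square mult.commute del: of_real_power)
  then have c: "coord u [] = complex_of_real ((norm a)\<^sup>2)" by (simp add: power2_norm_vec)
  have "(norm a)\<^sup>2 \<le> norm u"
    using coord_le_norm[of u "[]"] by (simp add: c norm_power)
  also have "norm u \<le> norm a" using u by (simp add: power2_le_iff_abs_le)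
  finally have "norm a * norm a \<le> norm a * 1" by (simp add: power2_eq_square)
  then have "norm a \<le> 1" using ge by (subst (asm) mult_le_cancel_left_pos) auto
  with ge have a1: "norm a = 1" by simp
  \<comment> \<open>The equality case of Cauchy-Schwarz: <u, 1> = 1 and |u| <= 1.\<close>
  have "(norm (u - ket []))\<^sup>2 = (norm u)\<^sup>2 - 1"
    using norm_add_sq[of "u - ket []" "ket []"] by (simp add: c a1)
  then have "(norm (u - ket []))\<^sup>2 \<le> 0" using u a1 by simp
  then have u1: "u = ket []" by simp
  have T: "(\<Sum>i\<in>UNIV. cnj (a $ i) *\<^sub>C \<psi> i x) = x" if "x \<in> ?N" for x
    using variety_algebra_fix_vacuum[OF variety_algebra_sum[OF alg, where c = "\<lambda>i. cnj (a $ i)"] vac _ that]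
      u1 vac that by (simp add: u_def)
  have "\<psi> i x = (a $ i) *\<^sub>C x" if x: "x \<in> ?N" for i x
  proof (rule ccontr)
    define h where "h = \<psi> i x - (a $ i) *\<^sub>C x"
    assume "\<psi> i x \<noteq> (a $ i) *\<^sub>C x"
    then have h0: "norm h > 0" by (simp add: h_def)
    have h: "h \<in> ?N" unfolding h_def using x by (intro ell2.subspace_diff[OF subspace_N_space] sub \<psi>_simps)
    \<comment> \<open>These choices give \<open>w + \<psi> i x = (s + 1) *\<^sub>R h\<close>,
      \<open>w + (a $ i) *\<^sub>C x = s *\<^sub>R h\<close> and
      \<open>s * (norm h)\<^sup>2 = (norm x)\<^sup>2\<close>; contractivity would then force |x|^2 +
      |h|^2 <= 0.\<close>
    define s where "s = (norm x)\<^sup>2 / (norm h)\<^sup>2"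
    define w where "w = s *\<^sub>R h - (a $ i) *\<^sub>C x"
    have w: "w \<in> ?N"
      unfolding w_def scaleR_scaleC using x h by (intro ell2.subspace_diff[OF subspace_N_space] sub)
    \<comment> \<open>By \<open>T\<close> the row sends the first part of this tuple to
      \<open>w\<close>; as |a| = 1, that part also has norm |w|.\<close>
    define y where "y j = cnj (a $ j) *\<^sub>C w + (if j = i then x else 0)" for j
    have y: "y j \<in> ?N" for j using w x by (simp add: y_def sub)
    have "\<psi> j (y j) = cnj (a $ j) *\<^sub>C \<psi> j w + (if j = i then \<psi> i x else 0)" for j
      using w x \<psi>_simps(3)[OF sub(1), of j 0] by (simp add: y_def \<psi>_simps sub)
    then have "(\<Sum>j\<in>UNIV. \<psi> j (y j)) = w + \<psi> i x"
      by (simp add: sum.distrib T w)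
    also have "\<dots> = (s + 1) *\<^sub>R h" by (simp add: w_def h_def algebra_simps)
    finally have "(norm (\<Sum>j\<in>UNIV. \<psi> j (y j)))\<^sup>2 = (s + 1)\<^sup>2 * (norm h)\<^sup>2"
      by (simp add: power_mult_distrib)
    moreover have "(\<Sum>j\<in>UNIV. (norm (y j))\<^sup>2) = (norm w)\<^sup>2 + 2 * Re (cinner w ((a $ i) *\<^sub>C x)) + (norm x)\<^sup>2"
    proof -
      have "(norm (y j))\<^sup>2 = (cmod (a $ j))\<^sup>2 * (norm w)\<^sup>2
          + (if j = i then 2 * Re (cinner w ((a $ i) *\<^sub>C x)) + (norm x)\<^sup>2 else 0)" for j
        by (simp add: y_def norm_add_sq norm_scaleC power_mult_distrib cinner_scaleC_left cinner_scaleC_right)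
      then show ?thesis
        using a1 power2_norm_vec[of a] by (simp add: sum.distrib flip: sum_distrib_right)
    qed
    moreover have "(norm w)\<^sup>2 + 2 * Re (cinner w ((a $ i) *\<^sub>C x)) + (cmod (a $ i) * norm x)\<^sup>2 = s\<^sup>2 * (norm h)\<^sup>2"
      using norm_add_sq[of w "(a $ i) *\<^sub>C x"] by (simp add: w_def norm_scaleC power_mult_distrib)
    ultimately have "(s + 1)\<^sup>2 * (norm h)\<^sup>2 \<le> s\<^sup>2 * (norm h)\<^sup>2 + (norm x)\<^sup>2"
      using contr[of y, OF y] zero_le_power2[of "cmod (a $ i) * norm x"] by linarith
    moreover have "s * (norm h)\<^sup>2 = (norm x)\<^sup>2" using h0 by (simp add: s_def)
    moreover have "(s + 1)\<^sup>2 * (norm h)\<^sup>2 = s\<^sup>2 * (norm h)\<^sup>2 + 2 * (s * (norm h)\<^sup>2) + (norm h)\<^sup>2"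
      by (simp add: power2_eq_square algebra_simps)
    moreover have "(norm h)\<^sup>2 > 0" using h0 by simp
    ultimately show False using zero_le_power2[of "norm x"] by linarith
  qed
  then have "\<psi> i = (\<lambda>x\<in>?N. (a $ i) *\<^sub>C x)" for i
    using bounded_opsD(4)[OF ops] by (auto simp: restrict_def)
  then show False using nonscalar by blast
qed

section \<open>Assembling the three statements\<close>

section \<open>The composition operator\<close>

text \<open>\<open>SUP\<close> and \<open>z_vec\<close> are total functions. The clauses on
  \<open>bdd_above\<close> and \<open>ball 0 1\<close> certify that the supremum and the vectors at
  symbol values are genuine; membership in \<open>bounded_ops\<close> does the same for the operator
  norm of the composition operator.\<close>

theorem theorem7p1:
  fixes \<P>\<^sub>0 :: "'n::finite ncpoly set"
    and \<psi> :: "'n \<Rightarrow> 'n fock \<Rightarrow> 'n fock"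
  assumes "\<forall>p\<in>\<P>\<^sub>0. ncpoly_eval p 0 = 0"
    and "\<forall>i. \<psi> i \<in> variety_algebra \<P>\<^sub>0"
    and "\<not> (\<exists>a :: complex ^ 'n. \<forall>i. \<psi> i = (\<lambda>x\<in>N_space \<P>\<^sub>0. (a $ i) *\<^sub>C x))"
    and "op_norm {x. \<forall>i. x $ i \<in> N_space \<P>\<^sub>0} (row_op \<psi>) \<le> 1"
  shows "(\<forall>g\<in>N_space \<P>\<^sub>0.
            summable (composition_term \<P>\<^sub>0 \<psi> g) \<and>
            suminf (composition_term \<P>\<^sub>0 \<psi> g) \<in> N_space \<P>\<^sub>0)
       \<and> (composition_op \<P>\<^sub>0 \<psi> \<in> bounded_ops (N_space \<P>\<^sub>0)
          \<and> (\<forall>\<mu>\<in>scalar_variety \<P>\<^sub>0. symbol_value \<psi> \<mu> \<in> ball 0 1)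
          \<and> bdd_above ((\<lambda>\<mu>. norm (orth_proj (N_space \<P>\<^sub>0) (z_vec (symbol_value \<psi> \<mu>))) / norm (z_vec \<mu>))
              ` scalar_variety \<P>\<^sub>0)
          \<and> norm (orth_proj (N_space \<P>\<^sub>0) (z_vec (symbol_value \<psi> 0)))
              \<le> (SUP \<mu>\<in>scalar_variety \<P>\<^sub>0.
                   norm (orth_proj (N_space \<P>\<^sub>0) (z_vec (symbol_value \<psi> \<mu>))) / norm (z_vec \<mu>))
          \<and> (SUP \<mu>\<in>scalar_variety \<P>\<^sub>0.
                norm (orth_proj (N_space \<P>\<^sub>0) (z_vec (symbol_value \<psi> \<mu>))) / norm (z_vec \<mu>))
              \<le> op_norm (N_space \<P>\<^sub>0) (composition_op \<P>\<^sub>0 \<psi>)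
          \<and> op_norm (N_space \<P>\<^sub>0) (composition_op \<P>\<^sub>0 \<psi>)
              \<le> sqrt ((1 + norm (symbol_value \<psi> 0)) / (1 - norm (symbol_value \<psi> 0))))
       \<and> (\<forall>g\<in>N_space \<P>\<^sub>0.
            (\<lambda>k. \<Sum>\<alpha> | length \<alpha> = k.
                cinner g (word_op (N_space \<P>\<^sub>0) \<psi> \<alpha> (ket [])) *\<^sub>C orth_proj (N_space \<P>\<^sub>0) (ket \<alpha>))
              sums adjoint_on (N_space \<P>\<^sub>0) (composition_op \<P>\<^sub>0 \<psi>) g)"
proof -
  define N v a where "N = N_space \<P>\<^sub>0" and "v = (ket [] :: 'n fock)" and "a = symbol_value \<psi> 0"
  note vacuum = vacuum_in_N_space[OF assms(1), folded N_def v_def]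
  have alg: "\<psi> i \<in> variety_algebra \<P>\<^sub>0" for i using assms(2) by blast
  note ops = variety_algebra_right_creation(1)[OF alg, folded N_def]
  have contr: "(norm (\<Sum>i\<in>UNIV. \<psi> i (y i)))\<^sup>2 \<le> (\<Sum>i\<in>UNIV. (norm (y i))\<^sup>2)"
    if "\<And>i. y i \<in> N" for y
    using row_contraction_norm_le[of \<psi> \<P>\<^sub>0 y] ops assms(4) that by (simp add: N_def)
  have norm_a: "norm a < 1"
    unfolding a_def using norm_symbol_value_0[of \<P>\<^sub>0 \<psi>] assms(1,3) alg contr by (simp add: N_def)
  have eigen: "cinner (\<psi> i x) (z_vec \<mu>) = symbol_value \<psi> \<mu> $ i * cinner x (z_vec \<mu>)"
    if "\<mu> \<in> scalar_variety \<P>\<^sub>0" "x \<in> N" for i x \<mu>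
    using variety_algebra_multiplicative[OF assms(1) alg that(1), of x i] that(2)
    by (simp add: symbol_value_def N_def)
  have 0: "0 \<in> scalar_variety \<P>\<^sub>0" using assms(1) by (simp add: scalar_variety_def)
  \<comment> \<open>The vacuum is \<open>z_vec 0\<close>, so its eigenvector property is the case
    \<mu> = 0 of \<open>eigen\<close>.\<close>
  interpret R: vacuum_row_contraction N \<psi> v a
  proof
    show "cinner (\<psi> i x) v = a $ i * cinner x v" if "x \<in> N" for i x
      using eigen[OF 0 that, of i] by (simp only: z_vec_0 v_def a_def)
  qed (use contr ops vacuum norm_a subspace_N_space closed_N_space in \<open>auto simp: N_def v_def\<close>)
  define C where "C = composition_op \<P>\<^sub>0 \<psi>"
  have comp_term: "composition_term \<P>\<^sub>0 \<psi> = R.comp_term"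
    by (intro ext) (simp add: composition_term_def R.comp_term_def R.orbit_def flip: N_def v_def)
  have C: "C = (\<lambda>g\<in>N. R.composition g)"
    by (simp add: C_def composition_op_def comp_term R.composition_def flip: N_def)
  have C_ops: "C \<in> bounded_ops N"
    unfolding bounded_ops_def C
    using R.composition_in R.norm_composition R.composition_linear R.N_closed
    by (auto intro!: exI[of _ "sqrt R.gram_const"])
  have C_le: "norm (C g) \<le> sqrt R.gram_const * norm g" if "g \<in> N" for g
    using that R.norm_composition by (simp add: C)
  have C_op_norm: "norm (C g) \<le> op_norm N C * norm g" if "g \<in> N" for g
    using R.gram_const_nonneg that by (intro norm_le_op_norm[OF _ C_le]) auto
  \<comment> \<open>\<open>R.coeff\<close> takes values in the full Fock space; compressing it to
    \<open>N\<close> gives the adjoint of \<open>C\<close>.\<close>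
  define A where "A = (\<lambda>g\<in>N. orth_proj N (R.coeff g))"
  note proj = bounded_linear_orth_proj[OF R.subspace R.closed] orth_proj(1)[OF R.subspace R.closed]
    orth_proj_cinner[OF R.subspace R.closed]
  have A_ops: "A \<in> bounded_ops N"
  proof -
    obtain K where K: "K > 0" "\<And>x. norm (orth_proj N x) \<le> norm x * K"
      using bounded_linear.pos_bounded[OF proj(1)] by blast
    have "norm (orth_proj N (R.coeff g)) \<le> (sqrt R.gram_const * K) * norm g" for g
    proof -
      have "norm (orth_proj N (R.coeff g)) \<le> norm (R.coeff g) * K" by (rule K(2))
      also have "\<dots> \<le> (sqrt R.gram_const * norm g) * K"
        using K(1) by (intro mult_right_mono R.norm_coeff) auto
      finally show ?thesis by (simp add: mult_ac)
    qed
    then show ?thesis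
      by (auto simp: bounded_ops_def A_def R.coeff_linear proj R.N_closed
          linear_add[OF bounded_linear.linear[OF proj(1)]])
  qed
  have adj: "adjoint_on N C = A"
    by (rule adjoint_on_eqI[OF R.subspace A_ops])
      (simp add: C A_def R.cinner_composition proj)
  have coeff_z: "R.coeff (z_vec \<mu>) = z_vec (symbol_value \<psi> \<mu>)" "norm (symbol_value \<psi> \<mu>) < 1"
    if \<mu>: "\<mu> \<in> scalar_variety \<P>\<^sub>0" for \<mu>
  proof -
    let ?b = "symbol_value \<psi> \<mu>"
    have lt: "norm \<mu> < 1" using \<mu> by (simp add: scalar_variety_def)
    have "cinner v (z_vec \<mu>) = 1" unfolding v_def by (rule cinner_vacuum_z[OF lt])
    \<comment> \<open>Multiplicativity turns words in the \<open>\<psi> i\<close>, evaluated at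
      \<open>z_vec \<mu>\<close>, into monomials in \<open>?b\<close>.\<close>
    then have "cinner (R.orbit \<alpha>) (z_vec \<mu>) = word_eval ?b \<alpha>" for \<alpha>
      by (induction \<alpha>) (simp_all add: word_eval_def eigen[OF \<mu> R.orbit_in])
    then have c: "coord (R.coeff (z_vec \<mu>)) \<alpha> = cnj (word_eval ?b \<alpha>)" for \<alpha>
      unfolding R.coord_coeff by (subst cinner_commute) simp
    show b: "norm ?b < 1"
    proof (rule ccontr)
      assume "\<not> norm ?b < 1"
      \<comment> \<open>Otherwise every word length would contribute at least 1 to the squared norm
        of \<open>R.coeff (z_vec \<mu>)\<close>, which is finite.\<close>
      then have ge: "1 \<le> norm ?b ^ (2 * k)" for k by (intro one_le_power) simp
      obtain m :: nat where m: "(norm (R.coeff (z_vec \<mu>)))\<^sup>2 < real m"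
        using reals_Archimedean2 by blast
      have "real m = (\<Sum>k<m. 1)" by simp
      also have "\<dots> \<le> (\<Sum>k<m. norm ?b ^ (2 * k))" by (intro sum_mono ge)
      also have "\<dots> = (\<Sum>k<m. \<Sum>\<alpha> | length \<alpha> = k. (cmod (coord (R.coeff (z_vec \<mu>)) \<alpha>))\<^sup>2)"
        by (simp add: c sum_word_eval)
      also have "\<dots> = (\<Sum>\<alpha>\<in>(\<Union>k<m. {\<alpha>. length \<alpha> = k}). (cmod (coord (R.coeff (z_vec \<mu>)) \<alpha>))\<^sup>2)"
        by (intro sum.UNION_disjoint[symmetric]) (auto intro!: finite_words)
      also have "\<dots> \<le> (norm (R.coeff (z_vec \<mu>)))\<^sup>2"
        by (rule sum_coord_le_norm) (auto intro!: finite_words)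
      finally show False using m by simp
    qed
    show "R.coeff (z_vec \<mu>) = z_vec ?b"
      by (rule ell2_eqI) (simp add: c coord_z_vec[OF b])
  qed
  define q where "q \<mu> = norm (orth_proj N (z_vec (symbol_value \<psi> \<mu>))) / norm (z_vec \<mu>)" for \<mu>
  have q_le: "q \<mu> \<le> op_norm N C" if \<mu>: "\<mu> \<in> scalar_variety \<P>\<^sub>0" for \<mu>
  proof -
    \<comment> \<open>Test vector for the lower bound: |g|^2 = <C g, z_\<mu>>, so Cauchy-Schwarz
      bounds |g| by the norm of \<open>C\<close> times |z_\<mu>|.\<close>
    define g where "g = orth_proj N (z_vec (symbol_value \<psi> \<mu>))"
    have g: "g \<in> N" by (simp add: g_def proj)
    have z: "norm (z_vec \<mu>) > 0"
      using cinner_vacuum_z[of \<mu>] \<mu> by (auto simp: scalar_variety_def)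
    have "complex_of_real ((norm g)\<^sup>2) = cinner g (z_vec (symbol_value \<psi> \<mu>))"
      unfolding cinner_self_norm[symmetric] using g by (simp add: g_def proj)
    also have "\<dots> = cinner (C g) (z_vec \<mu>)"
      using g by (simp add: C R.cinner_composition coeff_z[OF \<mu>])
    finally have "(norm g)\<^sup>2 = cmod (cinner (C g) (z_vec \<mu>))"
      by (metis abs_of_nonneg norm_of_real zero_le_power2)
    also have "\<dots> \<le> norm (C g) * norm (z_vec \<mu>)" by (rule cinner_Cauchy_Schwarz)
    also have "\<dots> \<le> op_norm N C * norm g * norm (z_vec \<mu>)"
      by (intro mult_right_mono C_op_norm g) auto
    finally have "norm g * norm g \<le> (op_norm N C * norm (z_vec \<mu>)) * norm g"
      by (simp add: power2_eq_square mult_ac)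
    moreover have "0 \<le> op_norm N C"
      using C_op_norm[OF vacuum] R.vacuum by (simp add: order_trans[OF norm_ge_zero])
    ultimately have "norm g \<le> op_norm N C * norm (z_vec \<mu>)"
      by (cases "g = 0") auto
    then show ?thesis using z by (simp add: q_def g_def divide_le_eq)
  qed
  have bdd: "bdd_above (q ` scalar_variety \<P>\<^sub>0)"
    using q_le by (auto intro!: bdd_aboveI)
  \<comment> \<open>The term at \<mu> = 0, where the denominator is 1.\<close>
  have "norm (orth_proj N (z_vec a)) \<le> (SUP \<mu>\<in>scalar_variety \<P>\<^sub>0. q \<mu>)"
    using cSUP_upper[OF 0 bdd] by (simp add: q_def a_def z_vec_0)
  moreover have "(SUP \<mu>\<in>scalar_variety \<P>\<^sub>0. q \<mu>) \<le> op_norm N C"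
    using 0 q_le by (intro cSUP_least) auto
  moreover have "op_norm N C \<le> sqrt ((1 + norm a) / (1 - norm a))"
    unfolding op_norm_def
  proof (rule cSUP_least)
    fix g assume "g \<in> N"
    then show "norm (C g) / norm g \<le> sqrt ((1 + norm a) / (1 - norm a))"
      using C_le[of g] R.gram_const_nonneg unfolding R.gram_const_def
      by (cases "g = 0") (auto simp: divide_le_eq)
  qed (use vacuum in auto)
  moreover have "(\<lambda>k. \<Sum>\<alpha> | length \<alpha> = k. cinner g (word_op N \<psi> \<alpha> v) *\<^sub>C orth_proj N (ket \<alpha>)) sums A g"
    if "g \<in> N" for g
  proof -
    \<comment> \<open>The basis expansion of \<open>R.coeff g\<close> passes through the continuous
      projection and is then grouped by word length.\<close>
    have "((\<lambda>\<alpha>. orth_proj N (coord (R.coeff g) \<alpha> *\<^sub>C ket \<alpha>)) has_sum A g) UNIV"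
      using has_sum_bounded_linear[OF proj(1) ell2_has_sum_ket[of "R.coeff g"]] that
      by (simp add: A_def o_def)
    then show ?thesis
      using has_sum_words_sums[of "\<lambda>\<alpha>. orth_proj N (coord (R.coeff g) \<alpha> *\<^sub>C ket \<alpha>)"]
      by (simp add: proj R.coord_coeff R.orbit_def)
  qed
  moreover have "summable (R.comp_term g)" "suminf (R.comp_term g) \<in> N" for g
    using R.summable_comp_term R.composition_in by (simp_all add: R.composition_def)
  ultimately show ?thesis
    using C_ops coeff_z(2) bdd
    unfolding comp_term C_def[symmetric] N_def[symmetric] v_def[symmetric] a_def[symmetric]
      q_def adj by auto
qed

end
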